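(* Let $n\ge 2$, $R>0$, $p\in\mathbb{R}^n$, and $$\beta=\left(\int_0^1\frac{ds}{(1-s^4)^{1/4}}\right)^4.$$ Then the problem $$\Delta_\infty u+\lambda u^3=0\ \text{ in }B_R(p),\quad\text{and}\quad u=0\ \text{ on }\partial B_R(p),$$ has infinitely many eigenvalues $\lambda$. Moreover, the following hold. (i) The eigenvalues given by $\lambda_\ell=\beta(2\ell-1)^4R^{-4}$, $\ell=1,2,\dots$, have corresponding radial eigenfunctions. (ii) Let $0\le\kappa<\tau<\infty$, $p\in\mathbb{R}^n$, and let $\Omega=\{x\in\mathbb{R}^n:\ \kappa<|x-p|<\tau\}$ be the spherical annulus centered at $p$. Set $2R=\tau-\kappa$ and $B=B_R(p)$. Then $\lambda_\Omega=\lambda_B=\beta R^{-4}$ (with weight $a\equiv 1$).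
   Context: $B_R(p)$ is the open ball of radius $R$ centered at $p$. The infinity-Laplacian is $\Delta_\infty u=\sum_{i,j=1}^n \frac{\partial u}{\partial x_i}\frac{\partial u}{\partial x_j}\frac{\partial^2 u}{\partial x_i\partial x_j}$. Differential equations are understood in the viscosity sense: for an open set $\Omega$ and $F\in C(\Omega\times\mathbb{R})$, a function $u\in C(\Omega)$ satisfies $\Delta_\infty u\ge F(x,u)$ in $\Omega$ if, whenever $\psi\in C^2(\Omega)$ and $u-\psi$ has a local maximum at $q\in\Omega$, one has $\Delta_\infty\psi(q)\ge F(q,u(q))$; it satisfies $\Delta_\infty u\le F(x,u)$ in $\Omega$ if, whenever $\psi\in C^2(\Omega)$ and $u-\psi$ has a local minimum at $q\in\Omega$, one has $\Delta_\infty\psi(q)\le F(q,u(q))$; $\Delta_\infty u=F(x,u)$ means both. Here $\Delta_\infty u+\lambda u^3=0$ means $\Delta_\infty u=-\lambda u^3$. A real number $\lambda$ is an eigenvalue of the problem on a bounded domain $\Omega$ if there is a function $u\in C(\overline{\Omega})$, $u\not\equiv 0$, solving $\Delta_\infty u+\lambda u^3=0$ in $\Omega$, $u=0$ on $\partial\Omega$; such $u$ is an eigenfunction corresponding to $\lambda$. "Radial" means depending only on $|x-p|$. For a bounded domain $\Omega$ the first eigenvalue (with weight $a\equiv1$) is $\lambda_\Omega=\sup S$, where, for a fixed $\delta>0$, $S$ is the set of all $\lambda\ge 0$ such that the problem $\Delta_\infty u+\lambda u^3=0$ in $\Omega$, $u=\delta$ on $\partial\Omega$, has a positive solution $u\in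 C(\overline{\Omega})$. By scaling, $S$ does not depend on $\delta>0$. $\lambda_B$ is the same quantity for $\Omega=B$. *)

theory Defs
  imports "HOL-Analysis.Analysis" "HOL-Library.Extended_Real"
begin

definition partial :: "'n::finite \<Rightarrow> (real^'n \<Rightarrow> real) \<Rightarrow> real^'n \<Rightarrow> real" where
  "partial i f x = frechet_derivative f (at x) (axis i 1)"

(* Only meant for open S. Differentiability of f and of its first partials makes
   the derivatives used below genuine (frechet_derivative is total) and gives the
   continuity of f and of its first partials. *)
definition C2_on :: "(real^'n::finite) set \<Rightarrow> (real^'n \<Rightarrow> real) \<Rightarrow> bool" where
  "C2_on S f \<longleftrightarrow>
     (\<forall>x\<in>S. f differentiable (at x)) \<and>
     (\<forall>i. \<forall>x\<in>S. partial i f differentiable (at x)) \<and>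
     (\<forall>i j. continuous_on S (partial i (partial j f)))"

definition inf_laplacian :: "(real^'n::finite \<Rightarrow> real) \<Rightarrow> real^'n \<Rightarrow> real" where
  "inf_laplacian f x =
     (\<Sum>i\<in>UNIV. \<Sum>j\<in>UNIV. partial i f x * partial j f x * partial i (partial j f) x)"

definition local_max_at :: "'a::metric_space set \<Rightarrow> ('a \<Rightarrow> real) \<Rightarrow> 'a \<Rightarrow> bool" where
  "local_max_at S f q \<longleftrightarrow> q \<in> S \<and> (\<exists>e>0. \<forall>x\<in>S \<inter> ball q e. f x \<le> f q)"

definition local_min_at :: "'a::metric_space set \<Rightarrow> ('a \<Rightarrow> real) \<Rightarrow> 'a \<Rightarrow> bool" where
  "local_min_at S f q \<longleftrightarrow> q \<in> S \<and> (\<exists>e>0. \<forall>x\<in>S \<inter> ball q e. f q \<le> f x)"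

(* Viscosity solutions of inf_laplacian u >= F(x,u), resp. <=, resp. =, in S;
   meant for open S and F continuous on S x R. *)
definition visc_ge ::
  "(real^'n::finite) set \<Rightarrow> (real^'n \<Rightarrow> real \<Rightarrow> real) \<Rightarrow> (real^'n \<Rightarrow> real) \<Rightarrow> bool" where
  "visc_ge S F u \<longleftrightarrow> continuous_on S u \<and>
     (\<forall>\<psi> q. C2_on S \<psi> \<and> local_max_at S (\<lambda>x. u x - \<psi> x) q \<longrightarrow> inf_laplacian \<psi> q \<ge> F q (u q))"

definition visc_le ::
  "(real^'n::finite) set \<Rightarrow> (real^'n \<Rightarrow> real \<Rightarrow> real) \<Rightarrow> (real^'n \<Rightarrow> real) \<Rightarrow> bool" where
  "visc_le S F u \<longleftrightarrow> continuous_on S u \<and>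
     (\<forall>\<psi> q. C2_on S \<psi> \<and> local_min_at S (\<lambda>x. u x - \<psi> x) q \<longrightarrow> inf_laplacian \<psi> q \<le> F q (u q))"

definition visc_eq ::
  "(real^'n::finite) set \<Rightarrow> (real^'n \<Rightarrow> real \<Rightarrow> real) \<Rightarrow> (real^'n \<Rightarrow> real) \<Rightarrow> bool" where
  "visc_eq S F u \<longleftrightarrow> visc_ge S F u \<and> visc_le S F u"

(* u is continuous on the closure of S, solves inf_laplacian u + lam u^3 = 0 in S
   and equals the constant c on the boundary of S. *)
definition dirichlet_solution ::
  "(real^'n::finite) set \<Rightarrow> real \<Rightarrow> real \<Rightarrow> (real^'n \<Rightarrow> real) \<Rightarrow> bool" where
  "dirichlet_solution S lam c u \<longleftrightarrow>
     continuous_on (closure S) u \<and>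
     visc_eq S (\<lambda>x t. - lam * t ^ 3) u \<and>
     (\<forall>x\<in>frontier S. u x = c)"

definition eigenfunction ::
  "(real^'n::finite) set \<Rightarrow> real \<Rightarrow> (real^'n \<Rightarrow> real) \<Rightarrow> bool" where
  "eigenfunction S lam u \<longleftrightarrow>
     dirichlet_solution S lam 0 u \<and> (\<exists>x\<in>closure S. u x \<noteq> 0)"

definition eigenvalue :: "(real^'n::finite) set \<Rightarrow> real \<Rightarrow> bool" where
  "eigenvalue S lam \<longleftrightarrow> (\<exists>u. eigenfunction S lam u)"

definition radial_on ::
  "(real^'n::finite) set \<Rightarrow> real^'n \<Rightarrow> (real^'n \<Rightarrow> real) \<Rightarrow> bool" where
  "radial_on S p u \<longleftrightarrow> (\<exists>g :: real \<Rightarrow> real. \<forall>x\<in>S. u x = g (norm (x - p)))"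

definition eigen_set :: "real \<Rightarrow> (real^'n::finite) set \<Rightarrow> real set" where
  "eigen_set \<delta> S =
     {lam. 0 \<le> lam \<and> (\<exists>u. dirichlet_solution S lam \<delta> u \<and> (\<forall>x\<in>closure S. 0 < u x))}"

(* The supremum is taken in the extended reals, so that a finite value also asserts
   that eigen_set is bounded above. *)
definition first_eigenvalue :: "real \<Rightarrow> (real^'n::finite) set \<Rightarrow> ereal" where
  "first_eigenvalue \<delta> S = (SUP lam\<in>eigen_set \<delta> S. ereal lam)"

definition beta_const :: real where
  "beta_const = (integral {0..1} (\<lambda>s::real. 1 / (1 - s ^ 4) powr (1 / 4))) ^ 4"

end

theory Submission
  imports Defs
begin

text \<open>
  For a radial function \<open>w(\<bar>x - q\<bar>)\<close> the equation reads \<open>(w')\<^sup>2 w'' + lam w\<^sup>3 = 0\<close>, which conserves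
  \<open>w'^4 + lam w^4\<close>.  Solutions are the rescalings \<open>c qcos (\<mu> (t - m))\<close>, with \<open>\<mu>^4 = lam\<close>, of one
  periodic function, a quartic analogue of the cosine.  Its quarter period is
  \<open>\<integral>\<^sub>0\<^sup>1 ds / (1 - s^4) powr (1/4)\<close>, that is \<open>quarter_period ^ 4 = beta_const\<close>.

  The function \<open>qcos\<close> is not \<open>C\<^sup>2\<close> at its extrema: there it behaves like \<open>1 - C \<bar>t\<bar> powr (4/3)\<close>.
  This is exactly what makes it a viscosity solution (\<open>radial_wave_visc_eq\<close>), since no
  \<open>C\<^sup>2\<close> function can touch such a crest from below.  Centred waves whose \<open>l\<close>-th zero is at radius
  \<open>R\<close>, i.e. \<open>\<mu> R = (2 l - 1) quarter_period\<close>, are radial eigenfunctions of the ball.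

  A wave with its crest at the centre of a ball, or on the middle sphere of an annulus, is positive
  up to the boundary if \<open>\<mu> r < quarter_period\<close>, where \<open>r\<close> is the radius or half the thickness.
  So both first eigenvalues are at least \<open>beta_const / r^4\<close>.  For the converse, both domains contain
  a ball of radius \<open>r\<close>, and \<open>positive_supersolution_bound\<close> says that a positive supersolution on
  such a ball forces \<open>lam \<le> beta_const / r^4\<close>.  It is proved by sliding under the supersolution the
  first eigenfunctions of slightly smaller balls with variable centre; either one of them touches it
  at a point where it can be used as a test function, or all touch at their centres, and then the
  supersolution is locally constant.
\<close>

section \<open>The quartic cosine\<close>

text \<open>
  Up to scaling, the radial profile of every solution below solves \<open>(w')\<^sup>2 w'' = - w\<^sup>3\<close>, whose energy is
  \<open>w'^4 + w^4\<close>.  At an extremum \<open>w'' = - w\<^sup>3 / (w')\<^sup>2\<close> is infinite, so this is not a Lipschitz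
  differential equation, and a construction from the inverse function of
  \<open>\<integral> ds / (1 - s^4) powr (1/4)\<close> would have to paste infinitely many branches.  Instead the energy
  curve \<open>x^4 + y^4 = 1\<close> is parametrised by the clockwise polar angle \<open>a\<close>: on it \<open>(x, y) =
  (cos a, - sin a) / (sin a ^ 4 + cos a ^ 4) powr (1/4)\<close>, and \<open>x' = y\<close> becomes
  \<open>dt/da = (sin a)\<^sup>2 / (sin a ^ 4 + cos a ^ 4)\<close>.  This is smooth, so time is a global, strictly
  increasing function of the angle; inverting it gives the whole periodic solution at once.
\<close>

definition quartic_norm :: "real \<Rightarrow> real" where
  "quartic_norm x = sin x ^ 4 + cos x ^ 4"

lemma quartic_norm_pos: "0 < quartic_norm x"
proof -
  have "2 * quartic_norm x = 1 + ((sin x)\<^sup>2 - (cos x)\<^sup>2)\<^sup>2"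
    using sin_cos_squared_add[of x] unfolding quartic_norm_def by algebra
  moreover have "0 \<le> ((sin x)\<^sup>2 - (cos x)\<^sup>2)\<^sup>2"
    by (rule zero_le_power2)
  ultimately show ?thesis by linarith
qed

lemma quartic_norm_le_1: "quartic_norm x \<le> 1"
proof -
  have "1 - quartic_norm x = 2 * (sin x * cos x)\<^sup>2"
    using sin_cos_squared_add[of x] unfolding quartic_norm_def by algebra
  moreover have "0 \<le> (sin x * cos x)\<^sup>2"
    by (rule zero_le_power2)
  ultimately show ?thesis by linarith
qed

definition quartic_time :: "real \<Rightarrow> real" where
  "quartic_time x = (LBINT y=ereal 0..ereal x. (sin y)\<^sup>2 / quartic_norm y)"

lemma quartic_time_0 [simp]: "quartic_time 0 = 0"
  by (simp add: quartic_time_def)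

lemma DERIV_quartic_time:
  "(quartic_time has_real_derivative (sin x)\<^sup>2 / quartic_norm x) (at x)"
proof -
  define a b where "a = min 0 x - 1" and "b = max 0 x + 1"
  have "continuous_on {a..b} (\<lambda>y. (sin y)\<^sup>2 / quartic_norm y)"
    using quartic_norm_pos unfolding quartic_norm_def
    by (intro continuous_intros) (metis less_irrefl)
  then have "((\<lambda>u. LBINT y=ereal 0..ereal u. (sin y)\<^sup>2 / quartic_norm y)
      has_vector_derivative (sin x)\<^sup>2 / quartic_norm x) (at x within {a..b})"
    by (intro interval_integral_FTC2) (auto simp: a_def b_def min_def max_def)
  then have "(quartic_time has_vector_derivative (sin x)\<^sup>2 / quartic_norm x) (at x within {a..b})"
    by (simp add: quartic_time_def[abs_def])
  moreover have "at x within {a..b} = at x"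
    by (rule at_within_interior) (auto simp: a_def b_def min_def max_def)
  ultimately show ?thesis
    by (simp only: has_real_derivative_iff_has_vector_derivative)
qed

lemmas has_real_derivative_quartic_time [derivative_intros] =
  DERIV_quartic_time[THEN DERIV_chain2]

lemma isCont_quartic_time: "isCont quartic_time x"
  using DERIV_quartic_time DERIV_isCont by blast

lemma quartic_time_odd: "quartic_time (- x) = - quartic_time x"
proof -
  have "((\<lambda>x. quartic_time x + quartic_time (- x)) has_real_derivative 0) (at x)" for x
    by (auto intro!: derivative_eq_intros simp: quartic_norm_def)
  then have "quartic_time x + quartic_time (- x) = quartic_time 0 + quartic_time (- 0)"
    using DERIV_isconst_all[of "\<lambda>x. quartic_time x + quartic_time (- x)" x 0] by simp
  then show ?thesis by simp
qed

lemma quartic_time_add_pi: "quartic_time (x + pi) = quartic_time x + quartic_time pi"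
proof -
  have "((\<lambda>x. quartic_time (x + pi) - quartic_time x) has_real_derivative 0) (at x)" for x
    by (auto intro!: derivative_eq_intros simp: quartic_norm_def)
  then have "quartic_time (x + pi) - quartic_time x = quartic_time (0 + pi) - quartic_time 0"
    using DERIV_isconst_all[of "\<lambda>x. quartic_time (x + pi) - quartic_time x" x 0] by simp
  then show ?thesis by simp
qed

text \<open>
  As \<open>quartic_norm \<le> 1\<close>, time grows at least as fast as the antiderivative of \<open>(sin x)\<^sup>2\<close>.  This
  makes the time strictly increasing although its derivative vanishes at multiples of \<open>\<pi>\<close>, and
  unbounded.
\<close>

lemma quartic_time_growth:
  assumes "x \<le> y"
  shows "(y - x) / 2 - (sin (2 * y) - sin (2 * x)) / 4 \<le> quartic_time y - quartic_time x"
proof -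
  define h where "h z = quartic_time z - (z / 2 - sin (2 * z) / 4)" for z
  have "(h has_real_derivative (sin z)\<^sup>2 / quartic_norm z - (sin z)\<^sup>2) (at z)" for z
    unfolding h_def using cos_double_sin[of z]
    by (auto intro!: derivative_eq_intros simp: field_simps)
  moreover have "(sin z)\<^sup>2 / quartic_norm z - (sin z)\<^sup>2 \<ge> 0" for z
    using quartic_norm_pos[of z] quartic_norm_le_1[of z]
    by (simp add: field_simps mult_left_le_one_le)
  ultimately have "h x \<le> h y"
    using DERIV_nonneg_imp_nondecreasing[OF assms] by blast
  then show ?thesis by (simp add: h_def field_simps)
qed

lemma abs_sin_less:
  fixes x :: real
  assumes "0 < x"
  shows "\<bar>sin x\<bar> < x"
proof (cases "sin (x / 2) = 0")
  case True
  then show ?thesis using assms sin_double[of "x / 2"] by simp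
next
  case False
  have "(cos (x / 2))\<^sup>2 < 1\<^sup>2"
    using False sin_cos_squared_add[of "x / 2"] by (simp add: cos_squared_eq)
  then have "\<bar>cos (x / 2)\<bar> < 1"
    by (metis abs_one power2_less_imp_less power2_abs zero_le_one)
  then have "\<bar>sin (x / 2)\<bar> * \<bar>cos (x / 2)\<bar> < \<bar>sin (x / 2)\<bar> * 1"
    using False by (intro mult_strict_left_mono) auto
  moreover have "\<bar>sin (x / 2)\<bar> \<le> x / 2"
    using abs_sin_x_le_abs_x[of "x / 2"] assms by simp
  ultimately show ?thesis
    using sin_double[of "x / 2"] by (simp add: abs_mult)
qed

lemma strict_mono_quartic_time: "strict_mono quartic_time"
proof (rule strict_monoI)
  fix x y :: real assume "x < y"
  have "sin (2 * y) - sin (2 * x) = 2 * sin (y - x) * cos (y + x)"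
    using sin_add[of "y + x" "y - x"] sin_diff[of "y + x" "y - x"] by simp
  also have "\<dots> \<le> 2 * \<bar>sin (y - x)\<bar>"
  proof -
    have "sin (y - x) * cos (y + x) \<le> \<bar>sin (y - x)\<bar> * \<bar>cos (y + x)\<bar>"
      by (metis abs_ge_self abs_mult)
    also have "\<dots> \<le> \<bar>sin (y - x)\<bar>"
      by (simp add: mult_left_le)
    finally show ?thesis by simp
  qed
  also have "\<dots> < 2 * (y - x)"
    using abs_sin_less[of "y - x"] \<open>x < y\<close> by simp
  finally have "0 < (y - x) / 2 - (sin (2 * y) - sin (2 * x)) / 4"
    by simp
  also have "\<dots> \<le> quartic_time y - quartic_time x"
    using quartic_time_growth \<open>x < y\<close> by simp
  finally show "quartic_time x < quartic_time y"
    by simp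
qed

lemma quartic_time_surj: "\<exists>x. quartic_time x = t"
proof -
  define b where "b = 2 * \<bar>t\<bar> + 1"
  have "0 \<le> b" by (simp add: b_def)
  then have "b / 2 - sin (2 * b) / 4 \<le> quartic_time b"
    using quartic_time_growth[of 0 b] by simp
  then have "\<bar>t\<bar> \<le> quartic_time b"
    using sin_le_one[of "2 * b"] b_def by linarith
  then have "quartic_time (- b) \<le> t" "t \<le> quartic_time b" "- b \<le> b"
    using \<open>0 \<le> b\<close> by (auto simp: quartic_time_odd)
  then show ?thesis
    using IVT[of quartic_time "- b" t b] isCont_quartic_time by blast
qed

definition quartic_angle :: "real \<Rightarrow> real" where
  "quartic_angle = inv quartic_time"

lemma quartic_angle_time [simp]: "quartic_angle (quartic_time x) = x"
  unfolding quartic_angle_def using strict_mono_quartic_time strict_mono_imp_inj_on by (metis inv_f_f)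

lemma quartic_time_angle [simp]: "quartic_time (quartic_angle t) = t"
  by (metis quartic_angle_time quartic_time_surj)

lemma quartic_angle_less_iff [simp]: "quartic_angle s < quartic_angle t \<longleftrightarrow> s < t"
  by (metis quartic_time_angle strict_mono_less strict_mono_quartic_time)

lemma isCont_quartic_angle: "isCont quartic_angle t"
proof -
  have "isCont quartic_angle (quartic_time (quartic_angle t))"
    by (rule isCont_inverse_function[of 1]) (simp_all add: isCont_quartic_time)
  then show ?thesis by simp
qed

lemma DERIV_quartic_angle:
  assumes "sin (quartic_angle t) \<noteq> 0"
  shows "(quartic_angle has_real_derivative
           quartic_norm (quartic_angle t) / (sin (quartic_angle t))\<^sup>2) (at t)"
proof -
  have "(quartic_angle has_real_derivative
           inverse ((sin (quartic_angle t))\<^sup>2 / quartic_norm (quartic_angle t))) (at t)"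
    by (rule DERIV_inverse_function[OF DERIV_quartic_time, where a="t - 1" and b="t + 1"])
      (use assms quartic_norm_pos[of "quartic_angle t"] isCont_quartic_angle in auto)
  then show ?thesis by simp
qed

lemma quartic_angle_odd: "quartic_angle (- t) = - quartic_angle t"
  by (metis quartic_angle_time quartic_time_angle quartic_time_odd)

lemma quartic_angle_0 [simp]: "quartic_angle 0 = 0"
  using quartic_angle_time[of 0] by simp

definition qcos :: "real \<Rightarrow> real" where
  "qcos t = cos (quartic_angle t) * quartic_norm (quartic_angle t) powr (- 1 / 4)"

definition qcos' :: "real \<Rightarrow> real" where
  "qcos' t = - sin (quartic_angle t) * quartic_norm (quartic_angle t) powr (- 1 / 4)"

definition quarter_period :: real where
  "quarter_period = quartic_time (pi / 2)"

lemma qcos_even: "qcos (- t) = qcos t"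
  by (simp add: qcos_def quartic_angle_odd quartic_norm_def)

lemma qcos_0 [simp]: "qcos 0 = 1"
  using quartic_angle_time[of 0] by (simp add: qcos_def quartic_norm_def)

lemma qcos'_eq_0_iff: "qcos' t = 0 \<longleftrightarrow> sin (quartic_angle t) = 0"
  using quartic_norm_pos[of "quartic_angle t"] by (simp add: qcos'_def)

lemma qcos'_0 [simp]: "qcos' 0 = 0"
  by (simp add: qcos'_eq_0_iff)

lemma qcos_energy: "qcos' t ^ 4 + qcos t ^ 4 = 1"
proof -
  define a P where "a = quartic_angle t" and "P = quartic_norm a powr (- 1 / 4)"
  have "P ^ 4 = 1 / quartic_norm a"
    using powr_power[of "quartic_norm a" "- 1 / 4" 4] quartic_norm_pos[of a]
    by (simp add: P_def powr_minus_divide)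
  moreover have "(- sin a * P) ^ 4 + (cos a * P) ^ 4 = quartic_norm a * P ^ 4"
    by (simp add: power_mult_distrib quartic_norm_def algebra_simps)
  ultimately show ?thesis
    using quartic_norm_pos[of a] by (simp add: qcos_def qcos'_def a_def[symmetric] P_def)
qed

lemma isCont_qcos: "isCont qcos t" and isCont_qcos': "isCont qcos' t"
  unfolding qcos_def[abs_def] qcos'_def[abs_def] quartic_norm_def
  using quartic_norm_pos[of "quartic_angle t"]
  by (auto intro!: continuous_intros isCont_quartic_angle simp: quartic_norm_def)


text \<open>
  The critical points of \<open>qcos\<close> are isolated; l'Hopital's rule below needs this.
\<close>

lemma eventually_qcos'_nonzero: "\<forall>\<^sub>F s in at t. qcos' s \<noteq> 0"
proof (cases "qcos' t = 0")
  case False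
  then show ?thesis
    using isCont_qcos'[of t] unfolding isCont_def
    by (rule tendsto_imp_eventually_ne[rotated])
next
  case True
  then have sin0: "sin (quartic_angle t) = 0"
    by (simp add: qcos'_eq_0_iff)
  have "(quartic_angle \<longlongrightarrow> quartic_angle t) (at t)"
    using isCont_quartic_angle isCont_def by blast
  then have "\<forall>\<^sub>F s in at t. dist (quartic_angle s) (quartic_angle t) < pi"
    by (rule tendstoD) simp
  moreover have "\<forall>\<^sub>F s in at t. s \<noteq> t"
    by (simp add: eventually_at_filter)
  ultimately show ?thesis
  proof eventually_elim
    case (elim s)
    let ?d = "quartic_angle s - quartic_angle t"
    have "?d \<noteq> 0" "\<bar>?d\<bar> < pi"
      using elim by (auto simp: dist_real_def) (metis quartic_time_angle)
    then have "sin ?d \<noteq> 0"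
      using sin_eq_0_pi[of ?d] by (auto simp: abs_less_iff)
    then show ?case
      using sin0 by (simp add: sin_diff qcos'_eq_0_iff)
  qed
qed


lemma DERIV_qcos_regular:
  assumes "qcos' t \<noteq> 0"
  shows "(qcos has_real_derivative qcos' t) (at t)"
    and "(qcos' has_real_derivative - (qcos t ^ 3 / (qcos' t)\<^sup>2)) (at t)"
proof -
  define a N where "a = quartic_angle t" and "N = quartic_norm a"
  have sin: "sin a \<noteq> 0" using assms by (simp add: qcos'_eq_0_iff a_def)
  have N: "N > 0" "N = sin a ^ 4 + cos a ^ 4"
    using quartic_norm_pos by (auto simp: N_def quartic_norm_def)
  have a: "(quartic_angle has_real_derivative N / (sin a)\<^sup>2) (at t)"
    using DERIV_quartic_angle[of t] sin by (simp add: a_def N_def)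
  have norm: "(quartic_norm has_real_derivative 4 * sin a * cos a * ((sin a)\<^sup>2 - (cos a)\<^sup>2)) (at a)"
    unfolding quartic_norm_def
    by (auto intro!: derivative_eq_intros simp: algebra_simps power2_eq_square power3_eq_cube)
  let ?P = "\<lambda>x. quartic_norm x powr (- 1 / 4)"
  have P: "(?P has_real_derivative
       - (sin a * cos a * ((sin a)\<^sup>2 - (cos a)\<^sup>2)) * ?P a / N) (at a)"
    by (rule DERIV_cong[OF DERIV_powr[OF norm, of "\<lambda>_. - 1 / 4" 0]])
      (use N(1) in \<open>simp_all add: N_def[symmetric] field_simps\<close>)
  have eq: "(sin a)\<^sup>2 + (cos a)\<^sup>2 = 1" by simp
  have "((\<lambda>x. cos x * ?P x) has_real_derivative - (sin a ^ 3) * ?P a / N) (at a)"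
  proof (rule DERIV_cong[OF DERIV_mult[OF DERIV_cos P]])
    have "- sin a * N - cos a * (sin a * cos a * ((sin a)\<^sup>2 - (cos a)\<^sup>2)) = - (sin a ^ 3)"
      using eq N(2) by algebra
    then show "- sin a * ?P a + - (sin a * cos a * ((sin a)\<^sup>2 - (cos a)\<^sup>2)) * ?P a / N * cos a
        = - (sin a ^ 3) * ?P a / N"
      using N(1) by (simp add: field_simps) algebra
  qed
  then have "(qcos has_real_derivative (- (sin a ^ 3) * ?P a / N) * (N / (sin a)\<^sup>2)) (at t)"
    unfolding qcos_def[abs_def] a_def by (rule DERIV_chain2) (use a in \<open>simp add: a_def\<close>)
  then show "(qcos has_real_derivative qcos' t) (at t)"
    using sin N(1) by (simp add: qcos'_def a_def[symmetric] power2_eq_square power3_eq_cube)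
  have "((\<lambda>x. - sin x * ?P x) has_real_derivative - (cos a ^ 3) * ?P a / N) (at a)"
  proof (rule DERIV_cong[OF DERIV_mult[OF DERIV_minus[OF DERIV_sin] P]])
    have "- cos a * N + sin a * (sin a * cos a * ((sin a)\<^sup>2 - (cos a)\<^sup>2)) = - (cos a ^ 3)"
      using eq N(2) by algebra
    then show "- cos a * ?P a + - (sin a * cos a * ((sin a)\<^sup>2 - (cos a)\<^sup>2)) * ?P a / N * - sin a
        = - (cos a ^ 3) * ?P a / N"
      using N(1) by (simp add: field_simps) algebra
  qed
  then have "(qcos' has_real_derivative (- (cos a ^ 3) * ?P a / N) * (N / (sin a)\<^sup>2)) (at t)"
    unfolding qcos'_def[abs_def] a_def by (rule DERIV_chain2) (use a in \<open>simp add: a_def\<close>)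
  moreover have "(- (cos a ^ 3) * ?P a / N) * (N / (sin a)\<^sup>2) = - (qcos t ^ 3 / (qcos' t)\<^sup>2)"
    using sin N(1) by (simp add: qcos_def qcos'_def a_def[symmetric] power_mult_distrib N_def[symmetric]
      power2_eq_square power3_eq_cube)
  ultimately show "(qcos' has_real_derivative - (qcos t ^ 3 / (qcos' t)\<^sup>2)) (at t)"
    by simp
qed

text \<open>
  At a critical point the angle, as a function of time, has infinite derivative, so the chain rule
  says nothing there; but \<open>qcos'\<close> is continuous and is the derivative nearby.
\<close>

lemma DERIV_qcos: "(qcos has_real_derivative qcos' t) (at t)"
proof -
  have "((\<lambda>s. (qcos s - qcos t) / (s - t)) \<longlongrightarrow> qcos' t) (at t)"
  proof (rule lhopital[where f' = qcos' and g' = "\<lambda>_. 1"])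
    show "((\<lambda>s. qcos s - qcos t) \<longlongrightarrow> 0) (at t)"
      using isCont_qcos[of t] by (simp add: isCont_def LIM_zero)
    show "\<forall>\<^sub>F s in at t. ((\<lambda>s. qcos s - qcos t) has_real_derivative qcos' s) (at s)"
      using eventually_qcos'_nonzero
      by eventually_elim (auto intro!: derivative_eq_intros DERIV_qcos_regular)
    show "((\<lambda>s. qcos' s / 1) \<longlongrightarrow> qcos' t) (at t)"
      using isCont_qcos'[of t] by (simp add: isCont_def)
  qed ((simp add: eventually_at_filter; fail) | (rule always_eventually, auto intro!: derivative_eq_intros; fail)
      | (auto intro!: tendsto_eq_intros; fail))+
  then show ?thesis by (simp add: has_field_derivative_iff)
qed

lemmas has_real_derivative_qcos [derivative_intros] = DERIV_qcos[THEN DERIV_chain2]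

lemma qcos_extremum_sq:
  assumes "qcos' t = 0"
  shows "(qcos t)\<^sup>2 = 1"
proof -
  have "(qcos t)\<^sup>2 ^ 2 = 1" using qcos_energy[of t] assms by (simp flip: power_mult)
  then show ?thesis by (smt (verit) power2_eq_1_iff zero_le_power2)
qed

text \<open>
  By l'Hopital twice: \<open>qcos''\<close> is infinite at an extremum.  Hence no \<open>C\<^sup>2\<close> function touches a
  positive maximum from below (or a negative minimum from above), so the viscosity inequality that
  would fail there is never tested.
\<close>

lemma qcos_extremum_superquadratic:
  assumes "qcos' t = 0"
  shows "filterlim (\<lambda>s. (1 - qcos t * qcos s) / (s - t)\<^sup>2) at_top (at t)"
proof (rule lhopital[where f' = "\<lambda>s. - qcos t * qcos' s" and g' = "\<lambda>s. 2 * (s - t)"])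
  have sq: "qcos t * qcos t = 1"
    using qcos_extremum_sq[OF assms] by (simp add: power2_eq_square)
  have lim: "(qcos \<longlongrightarrow> qcos t) (at t)" "(qcos' \<longlongrightarrow> 0) (at t)"
    using isCont_qcos[of t] isCont_qcos'[of t] assms by (simp_all add: isCont_def)
  show "((\<lambda>s. 1 - qcos t * qcos s) \<longlongrightarrow> 0) (at t)"
    using sq by (auto intro!: tendsto_eq_intros lim)
  show "\<forall>\<^sub>F s in at t. ((\<lambda>s. 1 - qcos t * qcos s) has_real_derivative - qcos t * qcos' s) (at s)"
    by (intro always_eventually allI) (auto intro!: derivative_eq_intros DERIV_qcos)
  show "filterlim (\<lambda>s. - qcos t * qcos' s / (2 * (s - t))) at_top (at t)"
  proof (rule lhopital[where f' = "\<lambda>s. qcos t * (qcos s ^ 3 / (qcos' s)\<^sup>2)" and g' = "\<lambda>s. 2"])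
    show "((\<lambda>s. - qcos t * qcos' s) \<longlongrightarrow> 0) (at t)"
      by (auto intro!: tendsto_eq_intros lim)
    show "\<forall>\<^sub>F s in at t. ((\<lambda>s. - qcos t * qcos' s) has_real_derivative
            qcos t * (qcos s ^ 3 / (qcos' s)\<^sup>2)) (at s)"
      using eventually_qcos'_nonzero
      by eventually_elim (auto intro!: derivative_eq_intros DERIV_qcos_regular)
    have "filterlim (\<lambda>s. (qcos t * qcos s ^ 3) / (2 * (qcos' s)\<^sup>2)) at_top (at t)"
    proof (rule LIM_at_top_divide)
      show "((\<lambda>s. qcos t * qcos s ^ 3) \<longlongrightarrow> 1) (at t)"
        using sq by (auto intro!: tendsto_eq_intros lim simp: power3_eq_cube)
      show "((\<lambda>s. 2 * (qcos' s)\<^sup>2) \<longlongrightarrow> 0) (at t)"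
        by (auto intro!: tendsto_eq_intros lim)
      show "\<forall>\<^sub>F s in at t. 0 < 2 * (qcos' s)\<^sup>2"
        using eventually_qcos'_nonzero[of t] by (rule eventually_mono) simp
    qed simp
    then show "filterlim (\<lambda>s. qcos t * (qcos s ^ 3 / (qcos' s)\<^sup>2) / 2) at_top (at t)"
      by (simp add: mult.commute)
  qed ((simp add: eventually_at_filter; fail) | (rule always_eventually, auto intro!: derivative_eq_intros; fail)
      | (auto intro!: tendsto_eq_intros; fail))+
qed ((simp add: eventually_at_filter; fail) | (rule always_eventually, auto intro!: derivative_eq_intros; fail)
      | (auto intro!: tendsto_eq_intros; fail))+

lemma quarter_period_pos: "0 < quarter_period"
  using strict_monoD[OF strict_mono_quartic_time, of 0 "pi / 2"]
  by (simp add: quarter_period_def)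

lemma abs_quartic_angle:
  assumes "\<bar>t\<bar> < quarter_period"
  shows "\<bar>quartic_angle t\<bar> < pi / 2"
proof -
  have "quartic_angle t < quartic_angle (quartic_time (pi / 2))"
    "quartic_angle (quartic_time (- (pi / 2))) < quartic_angle t"
    using assms by (simp_all only: quartic_angle_less_iff quartic_time_odd)
      (simp_all add: quarter_period_def abs_less_iff)
  then show ?thesis by (simp add: abs_less_iff)
qed

lemma qcos_pos:
  assumes "\<bar>t\<bar> < quarter_period"
  shows "0 < qcos t"
  using abs_quartic_angle[OF assms] quartic_norm_pos[of "quartic_angle t"]
  by (auto simp: qcos_def abs_less_iff intro!: mult_pos_pos cos_gt_zero_pi)

lemma qcos'_neg:
  assumes "0 < t" "t < quarter_period"
  shows "qcos' t < 0"
proof -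
  have "quartic_angle 0 < quartic_angle t"
    using assms by (simp only: quartic_angle_less_iff)
  then have "0 < sin (quartic_angle t)"
    using abs_quartic_angle[of t] assms by (intro sin_gt_zero) auto
  then show ?thesis
    using quartic_norm_pos[of "quartic_angle t"] by (simp add: qcos'_def mult_pos_pos)
qed

text \<open>
  The quarter period is the time from angle \<open>0\<close> to \<open>\<pi> / 2\<close>; each further half-turn takes two of
  them.
\<close>

lemma qcos_zero: "qcos ((2 * real k + 1) * quarter_period) = 0"
proof -
  have "quartic_time (pi / 2) = - quartic_time (pi / 2) + quartic_time pi"
    using quartic_time_add_pi[of "- (pi / 2)"] by (simp add: quartic_time_odd)
  then have pi: "quartic_time pi = 2 * quarter_period"
    by (simp add: quarter_period_def)
  have "quartic_time (pi / 2 + real k * pi) = (2 * real k + 1) * quarter_period"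
  proof (induction k)
    case (Suc k)
    have "pi / 2 + real (Suc k) * pi = (pi / 2 + real k * pi) + pi"
      by (simp add: algebra_simps)
    then show ?case
      using Suc quartic_time_add_pi[of "pi / 2 + real k * pi"] pi by (simp add: algebra_simps)
  qed (simp add: quarter_period_def)
  then have "quartic_angle ((2 * real k + 1) * quarter_period) = pi / 2 + real k * pi"
    by (metis quartic_angle_time)
  then show ?thesis by (simp add: qcos_def cos_add)
qed

lemma qcos_antimono:
  assumes "0 \<le> s" "s < t" "t \<le> quarter_period"
  shows "qcos t < qcos s"
proof (rule DERIV_neg_imp_decreasing_open[OF assms(2)])
  show "continuous_on {s..t} qcos"
    by (simp add: continuous_at_imp_continuous_on isCont_qcos)
  show "\<exists>y. DERIV qcos x :> y \<and> y < 0" if "s < x" "x < t" for x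
    using DERIV_qcos qcos'_neg[of x] that assms by auto
qed

text \<open>
  On the first quarter period \<open>qcos\<close> decreases from \<open>1\<close> to \<open>0\<close> with speed
  \<open>(1 - qcos^4) powr (1/4)\<close>.  So its inverse is, up to sign, an antiderivative of the integrand in
  \<^const>\<open>beta_const\<close>, continuous up to the singular endpoint \<open>1\<close>.
\<close>

lemma beta_const_eq: "beta_const = quarter_period ^ 4"
proof -
  let ?A = quarter_period
  have A: "qcos ?A = 0" using qcos_zero[of 0] by simp
  have inj: "inj_on qcos {0..?A}"
    by (rule linorder_inj_onI') (metis atLeastAtMost_iff less_irrefl qcos_antimono)
  define g where "g = the_inv_into {0..?A} qcos"
  have gq: "g (qcos t) = t" if "t \<in> {0..?A}" for t
    using the_inv_into_f_f[OF inj that] by (simp add: g_def)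
  have cont: "continuous_on {0..?A} qcos"
    by (simp add: continuous_at_imp_continuous_on isCont_qcos)
  have ex: "\<exists>t\<in>{0..?A}. qcos t = v" if "v \<in> {0..1}" for v
    using IVT2'[of qcos ?A v 0] that A quarter_period_pos cont by auto
  have img: "qcos ` {0..?A} = {0..1}"
  proof
    show "qcos ` {0..?A} \<subseteq> {0..1}"
    proof (clarsimp)
      fix t assume "0 \<le> t" "t \<le> ?A"
      then show "0 \<le> qcos t \<and> qcos t \<le> 1"
        using qcos_antimono[of 0 t] qcos_antimono[of t ?A] A by (cases "t = 0"; cases "t = ?A") auto
    qed
  qed (use ex in force)
  have contg: "continuous_on {0..1} g"
    using continuous_on_inv[OF cont, of g] gq by (simp add: img)
  have "((\<lambda>v. 1 / (1 - v ^ 4) powr (1 / 4)) has_integral - g 1 - - g 0) {0..1}"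
  proof (rule fundamental_theorem_of_calculus_interior)
    show "continuous_on {0..1} (\<lambda>v. - g v)"
      by (intro continuous_intros contg)
    fix v :: real assume v: "v \<in> {0<..<1}"
    then obtain t where t: "t \<in> {0..?A}" "qcos t = v" using ex[of v] by auto
    have gv: "g v = t" using gq t by auto
    have "t \<noteq> 0" "t \<noteq> ?A" using t v A by auto
    then have neg: "qcos' t < 0" using t by (intro qcos'_neg) auto
    have "(- qcos' t) ^ 4 = 1 - v ^ 4"
      using qcos_energy[of t] t by simp
    moreover have "(y ^ 4) powr (1 / 4) = y" if "0 < y" for y :: real
      using that by (simp add: powr_powr flip: powr_numeral)
    ultimately have root: "(1 - v ^ 4) powr (1 / 4) = - qcos' t"
      using neg by (metis neg_0_less_iff_less)
    have "(g has_real_derivative inverse (qcos' t)) (at v)"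
    proof (rule DERIV_inverse_function[where f = qcos and a = 0 and b = 1])
      show "(qcos has_real_derivative qcos' t) (at (g v))"
        using DERIV_qcos gv by simp
      show "qcos (g y) = y" if "0 < y" "y < 1" for y
        using ex[of y] gq that by force
      show "isCont g v"
        using contg v continuous_on_interior[of "{0..1}" g v] by simp
    qed (use neg v in auto)
    then have "((\<lambda>v. - g v) has_real_derivative 1 / (1 - v ^ 4) powr (1 / 4)) (at v)"
      by (auto intro!: derivative_eq_intros simp: root inverse_eq_divide)
    then show "((\<lambda>v. - g v) has_vector_derivative 1 / (1 - v ^ 4) powr (1 / 4)) (at v)"
      by (simp add: has_real_derivative_iff_has_vector_derivative)
  qed simp
  moreover have "g 1 = 0" "g 0 = ?A"
    using gq[of 0] gq[of ?A] A quarter_period_pos by auto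
  ultimately show ?thesis
    by (simp add: beta_const_def integral_unique)
qed

section \<open>Second-order information along lines\<close>


lemma strict_local_min_second_derivative:
  fixes h h' :: "real \<Rightarrow> real"
  assumes "\<forall>\<^sub>F x in nhds a. (h has_real_derivative h' x) (at x)"
    and "h' a = 0" and "(h' has_real_derivative L) (at a)" and "0 < L"
  shows "\<forall>\<^sub>F x in at a. h a < h x"
proof -
  obtain d1 where d1: "0 < d1" "\<And>x. dist x a < d1 \<Longrightarrow> (h has_real_derivative h' x) (at x)"
    using assms(1) unfolding eventually_nhds_metric by blast
  obtain d2 where d2: "0 < d2" "\<And>x. 0 < x \<Longrightarrow> x < d2 \<Longrightarrow> 0 < h' (a + x)"
    using DERIV_pos_inc_right[OF assms(3,4)] assms(2) by auto
  obtain d3 where d3: "0 < d3" "\<And>x. 0 < x \<Longrightarrow> x < d3 \<Longrightarrow> h' (a - x) < 0"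
    using DERIV_pos_inc_left[OF assms(3,4)] assms(2) by auto
  have cont: "isCont h x" if "dist x a < d1" for x
    using d1(2)[OF that] DERIV_isCont by blast
  have "h a < h x" if x: "x \<noteq> a" "dist x a < min d1 (min d2 d3)" for x
  proof (cases "a < x")
    case True
    show ?thesis
    proof (rule DERIV_pos_imp_increasing_open[OF True])
      show "\<exists>y. DERIV h z :> y \<and> 0 < y" if "a < z" "z < x" for z
        using d1(2)[of z] d2(2)[of "z - a"] that x by (auto simp: dist_real_def)
      show "continuous_on {a..x} h"
        using cont x True by (intro continuous_at_imp_continuous_on) (auto simp: dist_real_def)
    qed
  next
    case False
    then have "x < a" using x by simp
    then show ?thesis
    proof (rule DERIV_neg_imp_decreasing_open)
      show "\<exists>y. DERIV h z :> y \<and> y < 0" if "x < z" "z < a" for z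
        using d1(2)[of z] d3(2)[of "a - z"] that x by (auto simp: dist_real_def)
      show "continuous_on {x..a} h"
        using cont x \<open>x < a\<close> by (intro continuous_at_imp_continuous_on) (auto simp: dist_real_def)
    qed
  qed
  then show ?thesis
    unfolding eventually_at using d1(1) d2(1) d3(1)
    by (intro exI[of _ "min d1 (min d2 d3)"]) auto
qed

lemma partial_eqI:
  "(f has_derivative D) (at x) \<Longrightarrow> partial i f x = D (axis i 1)"
  unfolding partial_def using frechet_derivative_at by metis

lemma has_derivative_partial:
  fixes f :: "real^'n \<Rightarrow> real"
  assumes "f differentiable (at x)"
  shows "(f has_derivative (\<lambda>h. \<Sum>i\<in>UNIV. h $ i * partial i f x)) (at x)"
proof -
  let ?D = "frechet_derivative f (at x)"
  have D: "(f has_derivative ?D) (at x)"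
    using assms frechet_derivative_works by blast
  then have lin: "linear ?D"
    using has_derivative_linear by blast
  have "?D h = (\<Sum>i\<in>UNIV. h $ i * partial i f x)" for h
  proof -
    have "?D h = ?D (\<Sum>i\<in>UNIV. h $ i *\<^sub>R axis i 1)"
      using basis_expansion[of h] by (simp add: scalar_mult_eq_scaleR)
    also have "\<dots> = (\<Sum>i\<in>UNIV. h $ i * partial i f x)"
      by (simp add: linear_sum[OF lin] linear_cmul[OF lin] partial_def)
    finally show ?thesis .
  qed
  then have "?D = (\<lambda>h. \<Sum>i\<in>UNIV. h $ i * partial i f x)" by (rule ext)
  then show ?thesis using D by simp
qed

lemma DERIV_along_line:
  fixes f :: "real^'n \<Rightarrow> real"
  assumes "f differentiable (at (x + t *\<^sub>R e))"
  shows "((\<lambda>t. f (x + t *\<^sub>R e)) has_real_derivative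
           (\<Sum>i\<in>UNIV. e $ i * partial i f (x + t *\<^sub>R e))) (at t)"
proof -
  have "((\<lambda>t. x + t *\<^sub>R e) has_derivative (\<lambda>h. h *\<^sub>R e)) (at t)"
    by (auto intro!: derivative_eq_intros)
  from has_derivative_compose[OF this has_derivative_partial[OF assms]]
  show ?thesis
    by (rule has_derivative_imp_has_field_derivative)
      (simp add: sum_distrib_left mult_ac)
qed

text \<open>
  For \<open>C\<^sup>2\<close> functions this is the second derivative along the line through \<open>x\<close> with direction \<open>e\<close>.
\<close>

definition hessian_form :: "(real^'n::finite \<Rightarrow> real) \<Rightarrow> real^'n \<Rightarrow> real^'n \<Rightarrow> real" where
  "hessian_form f x e = (\<Sum>i\<in>UNIV. \<Sum>j\<in>UNIV. e $ i * e $ j * partial i (partial j f) x)"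

lemma C2_on_along_line:
  fixes f :: "real^'n \<Rightarrow> real" and e :: "real^'n"
  assumes "C2_on S f" "open S" "x \<in> S"
  defines "f' \<equiv> \<lambda>t. \<Sum>j\<in>UNIV. e $ j * partial j f (x + t *\<^sub>R e)"
  shows "\<forall>\<^sub>F t in nhds 0. ((\<lambda>t. f (x + t *\<^sub>R e)) has_real_derivative f' t) (at t)"
    and "(f' has_real_derivative hessian_form f x e) (at 0)"
proof -
  have "((\<lambda>t. x + t *\<^sub>R e) \<longlongrightarrow> x) (nhds 0)"
    by (auto intro!: tendsto_eq_intros filterlim_ident)
  then have "\<forall>\<^sub>F t in nhds 0. x + t *\<^sub>R e \<in> S"
    using assms(2,3) topological_tendstoD by blast
  then show "\<forall>\<^sub>F t in nhds 0. ((\<lambda>t. f (x + t *\<^sub>R e)) has_real_derivative f' t) (at t)"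
    by eventually_elim (use assms(1) in \<open>auto simp: f'_def C2_on_def intro: DERIV_along_line\<close>)
  have "((\<lambda>t. partial j f (x + t *\<^sub>R e)) has_real_derivative
           (\<Sum>i\<in>UNIV. e $ i * partial i (partial j f) x)) (at 0)" for j
    using DERIV_along_line[of "partial j f" x 0 e] assms(1,3) by (simp add: C2_on_def)
  then have "(f' has_real_derivative
      (\<Sum>j\<in>UNIV. e $ j * (\<Sum>i\<in>UNIV. e $ i * partial i (partial j f) x))) (at 0)"
    unfolding f'_def by (auto intro!: derivative_eq_intros sum.cong simp: mult.commute)
  also have "(\<Sum>j\<in>UNIV. e $ j * (\<Sum>i\<in>UNIV. e $ i * partial i (partial j f) x)) = hessian_form f x e"
    unfolding hessian_form_def sum_distrib_left by (subst sum.swap) (simp add: mult_ac)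
  finally show "(f' has_real_derivative hessian_form f x e) (at 0)" .
qed

text \<open>
  The infinity-Laplacian sees only the second derivative along the gradient.  This is what reduces
  the viscosity tests for radial functions to one variable.
\<close>

lemma inf_laplacian_eq_hessian_form:
  assumes "\<And>i. partial i f x = a * e $ i"
  shows "inf_laplacian f x = a\<^sup>2 * hessian_form f x e"
  unfolding inf_laplacian_def hessian_form_def assms sum_distrib_left
  by (simp add: power2_eq_square mult_ac)

lemma partial_uminus:
  assumes "f differentiable (at x)"
  shows "partial i (\<lambda>x. - f x) x = - partial i f x"
proof -
  have "(f has_derivative frechet_derivative f (at x)) (at x)"
    using assms frechet_derivative_works by blast
  from partial_eqI[OF has_derivative_minus[OF this]] show ?thesis
    by (simp add: partial_def)
qed

lemma differentiable_partial_cong: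
  assumes "open S" "x \<in> S" "\<And>y. y \<in> S \<Longrightarrow> f y = g y" "g differentiable (at x)"
  shows "f differentiable (at x)" "partial i f x = partial i g x"
proof -
  have g: "(g has_derivative frechet_derivative g (at x)) (at x)"
    using assms(4) frechet_derivative_works by blast
  then have f: "(f has_derivative frechet_derivative g (at x)) (at x)"
    by (rule has_derivative_transform_within_open[OF _ assms(1,2)]) (simp add: assms(3))
  show "f differentiable (at x)" using f differentiable_def by blast
  show "partial i f x = partial i g x"
    using partial_eqI[OF f] partial_eqI[OF g] by metis
qed

lemma C2_on_uminus:
  assumes "open S" "C2_on S f"
  shows "C2_on S (\<lambda>x. - f x)"
    and "x \<in> S \<Longrightarrow> inf_laplacian (\<lambda>x. - f x) x = - inf_laplacian f x"
proof -
  have f: "f differentiable (at x)" "partial j f differentiable (at x)" if "x \<in> S" for x j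
    using assms(2) that by (auto simp: C2_on_def)
  have p1: "partial j (\<lambda>x. - f x) x = - partial j f x" if "x \<in> S" for x j
    using partial_uminus f that by blast
  have diff: "(\<lambda>x. - partial j f x) differentiable (at x)" if "x \<in> S" for x j
    using f that by (intro differentiable_minus) auto
  have p2: "partial j (\<lambda>x. - f x) differentiable (at x)"
    "partial i (partial j (\<lambda>x. - f x)) x = - partial i (partial j f) x" if "x \<in> S" for x i j
    using differentiable_partial_cong[where f = "partial j (\<lambda>x. - f x)" and g = "\<lambda>x. - partial j f x",
        OF assms(1) that p1 diff[OF that]] partial_uminus[OF f(2)[OF that]] by auto
  have "continuous_on S (\<lambda>x. - partial i (partial j f) x)" for i j
    using assms(2) by (intro continuous_intros) (auto simp: C2_on_def)
  then have "continuous_on S (partial i (partial j (\<lambda>x. - f x)))" for i j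
    by (rule continuous_on_eq) (simp add: p2)
  then show "C2_on S (\<lambda>x. - f x)"
    unfolding C2_on_def using f p2 by (auto intro: differentiable_minus)
  show "inf_laplacian (\<lambda>x. - f x) x = - inf_laplacian f x" if "x \<in> S"
    using that by (simp add: inf_laplacian_def p1 p2 sum_negf)
qed

text \<open>
  \<open>\<Delta>\<^sub>\<infinity>\<close> is odd, so only one of the two viscosity inequalities has to be checked by hand.
\<close>

lemma visc_ge_if_visc_le_uminus:
  assumes "open S" "visc_le S (\<lambda>x t. - F x (- t)) (\<lambda>x. - u x)"
  shows "visc_ge S F u"
  unfolding visc_ge_def
proof (intro conjI allI impI; (elim conjE)?)
  have "continuous_on S (\<lambda>x. - u x)" using assms(2) by (simp add: visc_le_def)
  then show "continuous_on S u" using continuous_on_minus by fastforce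
  fix \<psi> q assume \<psi>: "C2_on S \<psi>" "local_max_at S (\<lambda>x. u x - \<psi> x) q"
  moreover have "- u q - - \<psi> q \<le> - u x - - \<psi> x \<longleftrightarrow> u x - \<psi> x \<le> u q - \<psi> q" for x
    by linarith
  ultimately have "local_min_at S (\<lambda>x. - u x - - \<psi> x) q" "q \<in> S"
    by (simp_all only: local_max_at_def local_min_at_def)
  then have "inf_laplacian (\<lambda>x. - \<psi> x) q \<le> - F q (- (- u q))"
    using assms(2) C2_on_uminus(1)[OF assms(1) \<psi>(1)] unfolding visc_le_def by blast
  then show "F q (u q) \<le> inf_laplacian \<psi> q"
    using C2_on_uminus(2)[OF assms(1) \<psi>(1) \<open>q \<in> S\<close>] by simp
qed

text \<open>
  Test functions have to be \<open>C\<^sup>2\<close> on the whole domain.  These polynomials are, and their three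
  coefficients can be fitted to any 2-jet of a radial profile at a positive radius.
\<close>

definition radial_quartic :: "real \<Rightarrow> real \<Rightarrow> real \<Rightarrow> real^'n::finite \<Rightarrow> real^'n \<Rightarrow> real" where
  "radial_quartic a b c y x = a + b * (norm (x - y))\<^sup>2 + c * (norm (x - y)) ^ 4"

lemma radial_quartic_C2:
  fixes x y :: "real^'n"
  shows "C2_on S (radial_quartic a b c y)"
    and "inf_laplacian (radial_quartic a b c y) x =
      (2 * b * norm (x - y) + 4 * c * norm (x - y) ^ 3)\<^sup>2 * (2 * b + 12 * c * (norm (x - y))\<^sup>2)"
proof -
  define k where "k x = 2 * b + 4 * c * ((x - y) \<bullet> (x - y))" for x
  have eq: "radial_quartic a b c y = (\<lambda>x. a + b * ((x - y) \<bullet> (x - y)) + c * ((x - y) \<bullet> (x - y))\<^sup>2)"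
    by (rule ext) (simp add: radial_quartic_def dot_square_norm flip: power_mult)
  have d1: "(radial_quartic a b c y has_derivative (\<lambda>h. k x * ((x - y) \<bullet> h))) (at x)" for x
    unfolding eq k_def
    by (auto intro!: derivative_eq_intros simp: inner_commute algebra_simps)
  have p1: "partial j (radial_quartic a b c y) = (\<lambda>x. k x * (x - y) $ j)" for j
    using partial_eqI[OF d1] by (auto simp: inner_axis)
  have d2: "((\<lambda>x. k x * (x - y) $ j) has_derivative
      (\<lambda>h. 8 * c * ((x - y) \<bullet> h) * (x - y) $ j + k x * h $ j)) (at x)" for x j
    unfolding k_def
    by (auto intro!: derivative_eq_intros bounded_linear_imp_has_derivative[OF bounded_linear_vec_nth]
        simp: inner_commute algebra_simps)
  have p2: "partial i (partial j (radial_quartic a b c y)) =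
      (\<lambda>x. 8 * c * (x - y) $ i * (x - y) $ j + k x * (if i = j then 1 else 0))" for i j
    unfolding p1 by (rule ext) (simp add: partial_eqI[OF d2] inner_axis del: vector_minus_component, simp add: axis_def)
  show "C2_on S (radial_quartic a b c y)"
    unfolding C2_on_def
  proof (intro conjI ballI allI)
    show "radial_quartic a b c y differentiable (at x)" for x
      using d1 differentiable_def by blast
    show "partial j (radial_quartic a b c y) differentiable (at x)" for x j
      unfolding p1 using d2 differentiable_def by blast
    show "continuous_on S (partial i (partial j (radial_quartic a b c y)))" for i j
      unfolding p2 k_def by (intro continuous_intros)
  qed
  define v s where "v = x - y" and "s = norm v"
  have s: "(\<Sum>i\<in>UNIV. v $ i * v $ i) = s\<^sup>2"
    by (simp add: s_def power2_norm_eq_inner inner_vec_def)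
  have kx: "k x = 2 * b + 4 * c * s\<^sup>2"
    by (simp add: k_def s_def v_def power2_norm_eq_inner)
  have "hessian_form (radial_quartic a b c y) x v =
      8 * c * ((\<Sum>i\<in>UNIV. v $ i * v $ i) * (\<Sum>j\<in>UNIV. v $ j * v $ j)) + k x * (\<Sum>i\<in>UNIV. v $ i * v $ i)"
  proof -
    have "v $ i * v $ j * (8 * c * v $ i * v $ j + k x * (if i = j then 1 else 0)) =
        8 * c * (v $ i * v $ i * (v $ j * v $ j)) + (if i = j then k x * (v $ j * v $ j) else 0)" for i j
      by (simp add: algebra_simps)
    then show ?thesis
      unfolding hessian_form_def p2 v_def[symmetric] sum_product
      by (simp add: sum.distrib sum_distrib_left)
  qed
  then have "hessian_form (radial_quartic a b c y) x v = s\<^sup>2 * (2 * b + 12 * c * s\<^sup>2)"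
    unfolding s kx by (simp add: algebra_simps)
  moreover have "inf_laplacian (radial_quartic a b c y) x =
      (k x)\<^sup>2 * hessian_form (radial_quartic a b c y) x v"
    by (rule inf_laplacian_eq_hessian_form) (simp add: p1 v_def)
  ultimately have "inf_laplacian (radial_quartic a b c y) x =
      (2 * b * s + 4 * c * s ^ 3)\<^sup>2 * (2 * b + 12 * c * s\<^sup>2)"
    unfolding kx by (simp add: algebra_simps power2_eq_square power3_eq_cube)
  then show "inf_laplacian (radial_quartic a b c y) x =
      (2 * b * norm (x - y) + 4 * c * norm (x - y) ^ 3)\<^sup>2 * (2 * b + 12 * c * (norm (x - y))\<^sup>2)"
    by (simp add: s_def v_def)
qed

section \<open>Radial waves are viscosity solutions\<close>


text \<open>
  With \<open>m = 0\<close> this is the solution centred at \<open>q\<close> with a crest at the centre; for an annulus the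
  crest is moved to the sphere of radius \<open>m\<close>.
\<close>

definition radial_wave :: "real \<Rightarrow> real \<Rightarrow> real \<Rightarrow> real^'n::finite \<Rightarrow> real^'n \<Rightarrow> real" where
  "radial_wave c \<mu> m q x = c * qcos (\<mu> * (norm (x - q) - m))"

lemma continuous_on_radial_wave: "continuous_on T (radial_wave c \<mu> m q)"
proof -
  have "continuous_on UNIV qcos"
    by (simp add: continuous_at_imp_continuous_on isCont_qcos)
  then have "continuous_on T (\<lambda>x. qcos (\<mu> * (norm (x - q) - m)))"
    by (rule continuous_on_compose2) (auto intro!: continuous_intros)
  then show ?thesis
    unfolding radial_wave_def[abs_def] by (rule continuous_on_mult_left)
qed

lemma has_derivative_radial_flat:
  fixes q :: "'a::real_normed_vector" and f :: "real \<Rightarrow> real"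
  assumes "(f has_real_derivative 0) (at 0)"
  shows "((\<lambda>x. f (norm (x - q))) has_derivative (\<lambda>_. 0)) (at q)"
proof -
  have "(f has_derivative (\<lambda>h. 0)) (at 0)"
    using assms by (simp add: has_field_derivative_def lambda_zero)
  then have *: "\<exists>d>0. \<forall>y. norm y < d \<longrightarrow> norm (f y - f 0) \<le> e * norm y" if "0 < e" for e
    using that by (simp add: has_derivative_at_alt)
  have "\<exists>d>0. \<forall>y. norm (y - q) < d \<longrightarrow> norm (f (norm (y - q)) - f 0) \<le> e * norm (y - q)"
    if e: "0 < e" for e
  proof -
    obtain d where "0 < d" "\<And>t. norm t < d \<Longrightarrow> norm (f t - f 0) \<le> e * norm t"
      using *[OF e] by blast
    from this(1) this(2)[of "norm (y - q)" for y] show ?thesis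
      by (intro exI[of _ d]) simp
  qed
  then show ?thesis
    by (simp add: has_derivative_at_alt)
qed

text \<open>
  The norm is smooth away from \<open>q\<close>; at \<open>x = q\<close>, where \<open>m = 0\<close>, its corner does no harm because the
  crest lies there and the profile is flat.
\<close>

lemma has_derivative_radial_wave:
  fixes q e :: "real^'n"
  assumes "x \<noteq> q \<or> m = 0" and "x - q = norm (x - q) *\<^sub>R e"
  shows "(radial_wave c \<mu> m q has_derivative
           (\<lambda>h. c * \<mu> * qcos' (\<mu> * (norm (x - q) - m)) * (e \<bullet> h))) (at x)"
proof (cases "x = q")
  case True
  with assms have m: "m = 0" by simp
  have "((\<lambda>t. c * qcos (\<mu> * t)) has_real_derivative 0) (at 0)"
    by (auto intro!: derivative_eq_intros)
  from has_derivative_radial_flat[OF this, of q] show ?thesis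
    by (simp add: radial_wave_def[abs_def] m True)
next
  case False
  define r where "r = norm (x - q)"
  have r: "r \<noteq> 0" "x - q = r *\<^sub>R e"
    using False assms(2) by (simp_all only: r_def) simp
  have "sgn (x - q) = inverse r *\<^sub>R (x - q)"
    by (simp add: sgn_div_norm r_def)
  also have "\<dots> = inverse r *\<^sub>R (r *\<^sub>R e)"
    by (simp only: r(2))
  finally have "sgn (x - q) = e"
    using r(1) by simp
  moreover have "((\<lambda>x. norm (x - q)) has_derivative (\<lambda>h. h \<bullet> sgn (x - q))) (at x)"
    by (rule has_derivative_compose[where f = "\<lambda>x. x - q" and f' = "\<lambda>h. h"])
      (use False in \<open>auto intro!: derivative_eq_intros has_derivative_norm\<close>)
  ultimately have "((\<lambda>x. norm (x - q)) has_derivative (\<lambda>h. e \<bullet> h)) (at x)"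
    by (simp add: inner_commute)
  then have "((\<lambda>x. \<mu> * (norm (x - q) - m)) has_derivative (\<lambda>h. \<mu> * (e \<bullet> h))) (at x)"
    by (auto intro!: derivative_eq_intros)
  from has_derivative_compose[OF this DERIV_qcos[unfolded has_field_derivative_def]]
  have "((\<lambda>x. qcos (\<mu> * (norm (x - q) - m))) has_derivative
      (\<lambda>h. qcos' (\<mu> * (norm (x - q) - m)) * (\<mu> * (e \<bullet> h)))) (at x)" .
  then show ?thesis
    unfolding radial_wave_def[abs_def]
    by (auto intro!: derivative_eq_intros simp: algebra_simps)
qed

text \<open>
  Along the ray through \<open>x\<close> the norm is affine.  At the centre it is the absolute value, which is
  harmless since \<open>qcos\<close> is even.
\<close>

lemma radial_wave_along_ray:
  fixes q e :: "real^'n"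
  assumes "x \<noteq> q \<or> m = 0" and "x - q = norm (x - q) *\<^sub>R e" and "norm e = 1"
  shows "\<forall>\<^sub>F t in nhds 0. radial_wave c \<mu> m q (x + t *\<^sub>R e)
           = c * qcos (\<mu> * (norm (x - q) - m) + \<mu> * t)"
proof -
  define r where "r = norm (x - q)"
  have "x + t *\<^sub>R e - q = (x - q) + t *\<^sub>R e" for t by simp
  then have "x + t *\<^sub>R e - q = (r + t) *\<^sub>R e" for t
    unfolding r_def using assms(2) by (simp only: scaleR_add_left)
  then have n: "norm (x + t *\<^sub>R e - q) = \<bar>r + t\<bar>" for t
    using assms(3) by simp
  show ?thesis
  proof (cases "x = q")
    case True
    then have "radial_wave c \<mu> m q (x + t *\<^sub>R e) = c * qcos (\<mu> * (norm (x - q) - m) + \<mu> * t)" for t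
      using assms(1) n[of t] qcos_even[of "\<mu> * t"]
      by (cases "0 \<le> t") (auto simp: radial_wave_def r_def)
    then show ?thesis by simp
  next
    case False
    then have "0 < r" by (simp add: r_def)
    then have "\<forall>\<^sub>F t in nhds 0. t \<in> {-r<..<r}"
      by (intro eventually_nhds_in_open) auto
    then show ?thesis
    proof eventually_elim
      case (elim t)
      then have "norm (x + t *\<^sub>R e - q) = r + t" using n by auto
      then show ?case by (simp add: radial_wave_def r_def algebra_simps)
    qed
  qed
qed

lemma radial_direction_exists:
  fixes v :: "real^'n"
  shows "\<exists>e. norm e = 1 \<and> v = norm v *\<^sub>R e"
proof (cases "v = 0")
  case True
  then show ?thesis
    by (intro exI[of _ "axis undefined 1"]) simp
next
  case False
  then show ?thesis
    by (intro exI[of _ "v /\<^sub>R norm v"]) simp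
qed

lemma eventually_nhds_imp_at: "eventually P (nhds a) \<Longrightarrow> eventually P (at a)"
  by (auto simp: eventually_at_filter elim: eventually_mono)

text \<open>
  Let \<open>\<psi>\<close> touch the wave from below at \<open>x\<close>.  Its gradient there is the radial one.  If the profile
  is not critical, it is \<open>C\<^sup>2\<close> near \<open>x\<close>, and comparing second derivatives along the ray
  gives the inequality from the profile's differential equation.  If it is critical, then
  \<open>\<Delta>\<^sub>\<infinity> \<psi> = 0\<close>, and only a positive wave value would violate the inequality; but at a positive
  maximum the wave leaves its value faster than quadratically, so \<open>\<psi>\<close> could not lie below it.
\<close>

lemma radial_wave_visc_le:
  fixes q :: "real^'n"
  assumes S: "open S" "q \<notin> S \<or> m = 0" and \<mu>: "0 < \<mu>"
  shows "visc_le S (\<lambda>x t. - (\<mu> ^ 4) * t ^ 3) (radial_wave c \<mu> m q)"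
  unfolding visc_le_def
proof (intro conjI allI impI continuous_on_radial_wave, elim conjE)
  fix \<psi> x assume C2: "C2_on S \<psi>" and min: "local_min_at S (\<lambda>x. radial_wave c \<mu> m q x - \<psi> x) x"
  let ?u = "radial_wave c \<mu> m q"
  have x: "x \<in> S" using min by (simp add: local_min_at_def)
  have center: "x \<noteq> q \<or> m = 0" using x S by auto
  obtain e :: "real^'n" where e: "norm e = 1" "x - q = norm (x - q) *\<^sub>R e"
    using radial_direction_exists by metis
  define s where "s = \<mu> * (norm (x - q) - m)"
  have ux: "?u x = c * qcos s" by (simp add: radial_wave_def s_def)
  obtain d where d: "0 < d" "\<And>y. y \<in> S \<inter> ball x d \<Longrightarrow> ?u x - \<psi> x \<le> ?u y - \<psi> y"
    using min unfolding local_min_at_def by auto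
  have "open (S \<inter> ball x d)" "x \<in> S \<inter> ball x d" using S x d by auto
  then have near: "\<forall>\<^sub>F y in nhds x. ?u x - \<psi> x \<le> ?u y - \<psi> y"
    using d(2) eventually_nhds by blast
  have diff: "\<psi> differentiable (at x)" using C2 x by (simp add: C2_on_def)
  define D where "D = frechet_derivative \<psi> (at x)"
  have "((\<lambda>y. ?u y - \<psi> y) has_derivative (\<lambda>h. c * \<mu> * qcos' s * (e \<bullet> h) - D h)) (at x)"
    unfolding D_def s_def using diff
    by (intro has_derivative_diff has_derivative_radial_wave[OF center e(2)])
      (simp add: frechet_derivative_works)
  from has_derivative_local_min[OF this]
  have "(\<lambda>h. c * \<mu> * qcos' s * (e \<bullet> h) - D h) = (\<lambda>h. 0)"
    using eventually_nhds_imp_at[OF near] by simp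
  then have "D h = c * \<mu> * qcos' s * (e \<bullet> h)" for h
    by (auto dest!: fun_cong[of _ _ h])
  then have grad: "partial i \<psi> x = (c * \<mu> * qcos' s) * e $ i" for i
    unfolding partial_def D_def[symmetric] by (simp add: inner_axis)
  let ?H = "hessian_form \<psi> x e"
  have lap: "inf_laplacian \<psi> x = (c * \<mu> * qcos' s)\<^sup>2 * ?H"
    using grad by (rule inf_laplacian_eq_hessian_form)
  define f where "f t = \<psi> (x + t *\<^sub>R e)" for t
  define f' where "f' t = (\<Sum>j\<in>UNIV. e $ j * partial j \<psi> (x + t *\<^sub>R e))" for t
  have f: "\<forall>\<^sub>F t in nhds 0. (f has_real_derivative f' t) (at t)" "(f' has_real_derivative ?H) (at 0)"
    using C2_on_along_line[OF C2 S(1) x, of e] by (simp_all add: f_def[abs_def] f'_def[abs_def])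
  have f'0: "f' 0 = c * \<mu> * qcos' s"
  proof -
    have "(\<Sum>j\<in>UNIV. e $ j * e $ j) = 1"
      using e(1) by (simp add: norm_eq_1 inner_vec_def)
    moreover have "f' 0 = (\<Sum>j\<in>UNIV. (c * \<mu> * qcos' s) * (e $ j * e $ j))"
      unfolding f'_def by (intro sum.cong refl) (simp add: grad)
    ultimately show ?thesis
      by (simp only: flip: sum_distrib_left)
  qed
  have "((\<lambda>t. x + t *\<^sub>R e) \<longlongrightarrow> x) (nhds 0)"
    by (auto intro!: tendsto_eq_intros filterlim_ident)
  then have "\<forall>\<^sub>F t in nhds 0. ?u x - \<psi> x \<le> ?u (x + t *\<^sub>R e) - \<psi> (x + t *\<^sub>R e)"
    by (rule eventually_compose_filterlim[OF near])
  then have touch: "\<forall>\<^sub>F t in nhds 0. c * qcos s - f 0 \<le> c * qcos (s + \<mu> * t) - f t"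
    using radial_wave_along_ray[OF center e(2,1), of c \<mu>]
    by eventually_elim (simp add: f_def ux s_def)
  show "inf_laplacian \<psi> x \<le> - (\<mu> ^ 4) * ?u x ^ 3"
  proof (cases "qcos' s = 0")
    case False
    define L where "L = c * (\<mu>\<^sup>2 * - (qcos s ^ 3 / (qcos' s)\<^sup>2))"
    have "?H \<le> L"
    proof (rule ccontr)
      assume "\<not> ?H \<le> L"
      then have pos: "0 < ?H - L" by simp
      have "\<forall>\<^sub>F t in at 0. f 0 - c * qcos (s + \<mu> * 0) < f t - c * qcos (s + \<mu> * t)"
      proof (rule strict_local_min_second_derivative[OF _ _ _ pos])
        show "\<forall>\<^sub>F t in nhds 0. ((\<lambda>t. f t - c * qcos (s + \<mu> * t)) has_real_derivative
                f' t - c * (\<mu> * qcos' (s + \<mu> * t))) (at t)"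
          using f(1)
          by eventually_elim (auto intro!: derivative_eq_intros)
        show "f' 0 - c * (\<mu> * qcos' (s + \<mu> * 0)) = 0"
          by (simp add: f'0)
        have "(qcos' has_real_derivative - (qcos s ^ 3 / (qcos' s)\<^sup>2)) (at (s + \<mu> * 0))"
          using DERIV_qcos_regular(2)[OF False] by simp
        moreover have "((\<lambda>t. s + \<mu> * t) has_real_derivative \<mu>) (at 0)"
          by (auto intro!: derivative_eq_intros)
        ultimately have "((\<lambda>t. qcos' (s + \<mu> * t)) has_real_derivative
            - (qcos s ^ 3 / (qcos' s)\<^sup>2) * \<mu>) (at 0)"
          by (rule DERIV_chain2[where f = qcos' and g = "\<lambda>t. s + \<mu> * t" and x = 0])
        then show "((\<lambda>t. f' t - c * (\<mu> * qcos' (s + \<mu> * t))) has_real_derivative ?H - L) (at 0)"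
          using f(2) by (auto intro!: derivative_eq_intros simp: L_def power2_eq_square)
      qed
      moreover have "\<forall>\<^sub>F t in at 0. c * qcos s - f 0 \<le> c * qcos (s + \<mu> * t) - f t"
        using touch by (rule eventually_nhds_imp_at)
      ultimately have "\<forall>\<^sub>F t in at (0::real). False"
        by eventually_elim simp
      then show False by simp
    qed
    then have "inf_laplacian \<psi> x \<le> (c * \<mu> * qcos' s)\<^sup>2 * L"
      unfolding lap by (intro mult_left_mono) auto
    also have "\<dots> = - (\<mu> ^ 4) * ?u x ^ 3"
      using False unfolding ux L_def by (simp add: field_simps power2_eq_square power3_eq_cube power4_eq_xxxx)
    finally show ?thesis .
  next
    case True
    have "c * qcos s \<le> 0"
    proof (rule ccontr)
      assume "\<not> c * qcos s \<le> 0"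
      then have cpos: "0 < c * qcos s" by simp
      have sq: "qcos s * qcos s = 1"
        using qcos_extremum_sq[OF True] by (simp add: power2_eq_square)
      \<comment> \<open>\<open>\<psi>\<close> decreases at most like \<open>K t\<^sup>2\<close> along the ray, the wave faster.\<close>
      define K where "K = \<bar>?H\<bar> + 1"
      have "\<forall>\<^sub>F t in at 0. f 0 + K * 0\<^sup>2 < f t + K * t\<^sup>2"
      proof (rule strict_local_min_second_derivative)
        show "\<forall>\<^sub>F t in nhds 0. ((\<lambda>t. f t + K * t\<^sup>2) has_real_derivative f' t + 2 * K * t) (at t)"
          using f(1) by eventually_elim (auto intro!: derivative_eq_intros)
        show "f' 0 + 2 * K * 0 = 0" using f'0 True by simp
        show "((\<lambda>t. f' t + 2 * K * t) has_real_derivative ?H + 2 * K) (at 0)"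
          using f(2) by (auto intro!: derivative_eq_intros)
        show "0 < ?H + 2 * K" by (simp add: K_def)
      qed
      moreover have "\<forall>\<^sub>F t in at 0. c * qcos s - f 0 \<le> c * qcos (s + \<mu> * t) - f t"
        using touch by (rule eventually_nhds_imp_at)
      moreover have "\<forall>\<^sub>F t in at 0. K / (c * qcos s * \<mu>\<^sup>2) < (1 - qcos s * qcos (s + \<mu> * t)) / (s + \<mu> * t - s)\<^sup>2"
      proof -
        have "filterlim (\<lambda>t. s + \<mu> * t) (at s) (at 0)"
          unfolding filterlim_at using \<mu>
          by (auto intro!: tendsto_eq_intros simp: eventually_at_filter)
        from filterlim_compose[OF qcos_extremum_superquadratic[OF True] this]
        show ?thesis by (simp add: filterlim_at_top_dense)
      qed
      moreover have "\<forall>\<^sub>F t in at (0::real). t \<noteq> 0"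
        by (simp add: eventually_at_filter)
      ultimately have "\<forall>\<^sub>F t in at (0::real). False"
      proof eventually_elim
        case (elim t)
        have "0 < (\<mu> * t)\<^sup>2" using elim(4) \<mu> by simp
        then have "K / (c * qcos s * \<mu>\<^sup>2) * (\<mu> * t)\<^sup>2 < 1 - qcos s * qcos (s + \<mu> * t)"
          using elim(3) by (simp only: pos_less_divide_eq add_diff_cancel_left')
        moreover have "K / (c * qcos s * \<mu>\<^sup>2) * (\<mu> * t)\<^sup>2 = K * t\<^sup>2 / (c * qcos s)"
          using \<mu> by (simp add: power_mult_distrib)
        ultimately have "K * t\<^sup>2 < c * qcos s * (1 - qcos s * qcos (s + \<mu> * t))"
          using cpos by (simp only: pos_divide_less_eq mult.commute)
        also have "\<dots> = c * qcos s - c * qcos (s + \<mu> * t) * (qcos s * qcos s)"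
          by (simp add: algebra_simps)
        also have "\<dots> = c * qcos s - c * qcos (s + \<mu> * t)"
          by (simp add: sq)
        finally show False using elim(1,2) by simp
      qed
      then show False by simp
    qed
    then have "(c * qcos s) ^ 3 \<le> 0"
      by (simp add: power3_eq_cube mult_nonneg_nonpos zero_le_mult_iff mult_le_0_iff)
    then show ?thesis
      unfolding lap ux using True \<mu> by (simp add: mult_nonneg_nonpos)
  qed
qed

lemma radial_wave_visc_eq:
  fixes q :: "real^'n"
  assumes "open S" "q \<notin> S \<or> m = 0" "0 < \<mu>"
  shows "visc_eq S (\<lambda>x t. - (\<mu> ^ 4) * t ^ 3) (radial_wave c \<mu> m q)"
proof -
  have "(\<lambda>x. - radial_wave c \<mu> m q x) = radial_wave (- c) \<mu> m q"
    by (simp add: radial_wave_def fun_eq_iff)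
  then have "visc_ge S (\<lambda>x t. - (\<mu> ^ 4) * t ^ 3) (radial_wave c \<mu> m q)"
    using radial_wave_visc_le[OF assms, of "- c"]
    by (intro visc_ge_if_visc_le_uminus assms) simp
  then show ?thesis
    using radial_wave_visc_le[OF assms] by (simp add: visc_eq_def)
qed

section \<open>Upper bound for positive supersolutions\<close>


lemma filterlim_norm_diff: "filterlim (\<lambda>x. norm (x - y)) (nhds (norm (x - y))) (nhds x)"
  by (auto intro!: tendsto_eq_intros filterlim_ident)

lemma local_min_atI:
  assumes "x \<in> S" "\<forall>\<^sub>F y in nhds x. f x \<le> f y"
  shows "local_min_at S f x"
proof -
  obtain e where "0 < e" "\<And>y. dist y x < e \<Longrightarrow> f x \<le> f y"
    using assms(2) unfolding eventually_nhds_metric by blast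
  then show ?thesis
    using assms(1) by (auto simp: local_min_at_def dist_commute intro!: exI[of _ e])
qed

text \<open>
  Let \<open>w\<close> be the first eigenfunction of \<open>ball y \<rho>\<close>, with eigenvalue \<open>\<mu>^4 < lam\<close>, and let \<open>k w\<close>
  be its largest multiple below \<open>u\<close>.  The two functions touch at an interior point.  Away from the
  centre \<open>k w\<close> is \<open>C\<^sup>2\<close> and a strict subsolution of the equation with \<open>lam\<close>, so (slightly bent
  downwards and fitted by a radial quartic) it contradicts the supersolution property of \<open>u\<close>.
  Hence they touch at the centre, where \<open>w = 1\<close>, and \<open>k = u y\<close>.
\<close>

lemma supersolution_above_bump:
  fixes y :: "real^'n"
  assumes S: "cball y \<rho> \<subseteq> S" and \<mu>: "0 < \<mu>" "\<mu> * \<rho> = quarter_period" "\<mu> ^ 4 < lam"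
    and u: "visc_le S (\<lambda>x t. - lam * t ^ 3) u" "\<And>x. x \<in> cball y \<rho> \<Longrightarrow> 0 < u x"
    and x: "x \<in> cball y \<rho>"
  shows "u y * qcos (\<mu> * norm (x - y)) \<le> u x"
proof -
  define w where "w x = qcos (\<mu> * norm (x - y))" for x
  have \<rho>: "0 < \<rho>"
    using \<mu>(1) zero_less_mult_pos[of \<mu> \<rho>] \<mu>(2) quarter_period_pos by simp
  have "continuous_on T w" for T
    using continuous_on_radial_wave[of T 1 \<mu> 0 y] by (simp add: radial_wave_def[abs_def] w_def[abs_def])
  moreover have "continuous_on (cball y \<rho>) u"
    using u(1) S continuous_on_subset unfolding visc_le_def by blast
  ultimately have "continuous_on (cball y \<rho>) (\<lambda>x. w x / u x)"
    by (intro continuous_on_divide) (use u(2) in force)+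
  then obtain x0 where x0: "x0 \<in> cball y \<rho>" "\<And>x. x \<in> cball y \<rho> \<Longrightarrow> w x / u x \<le> w x0 / u x0"
    using continuous_attains_sup[of "cball y \<rho>" "\<lambda>x. w x / u x"] \<rho> by auto
  have ux0: "0 < u x0" using u(2) x0 by blast
  have "0 < w y / u y" using u(2)[of y] \<rho> by (simp add: w_def)
  also have "\<dots> \<le> w x0 / u x0" using x0(2)[of y] \<rho> by simp
  finally have wx0: "0 < w x0" using ux0 by (simp add: zero_less_divide_iff)
  define k where "k = u x0 / w x0"
  have k: "0 < k" "k * w x0 = u x0" using ux0 wx0 by (simp_all add: k_def)
  have above: "k * w x \<le> u x" if "x \<in> cball y \<rho>" for x
    using x0(2)[OF that] u(2)[OF that] ux0 wx0 by (simp add: k_def field_simps)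
  have "x0 = y"
  proof (rule ccontr)
    assume "x0 \<noteq> y"
    define s where "s = norm (x0 - y)"
    have s: "0 < s" using \<open>x0 \<noteq> y\<close> by (simp add: s_def)
    have "s \<le> \<rho>" using x0(1) by (simp add: s_def dist_norm norm_minus_commute)
    moreover have "s \<noteq> \<rho>"
      using wx0 qcos_zero[of 0] \<mu>(2) by (auto simp: w_def s_def)
    ultimately have "s < \<rho>" by simp
    then have "\<mu> * s < quarter_period"
      using mult_strict_left_mono[OF _ \<mu>(1)] \<mu>(2) by metis
    define C D where "C = qcos (\<mu> * s)" and "D = qcos' (\<mu> * s)"
    have D: "D < 0"
      unfolding D_def using \<open>\<mu> * s < quarter_period\<close> \<mu>(1) s by (intro qcos'_neg) auto
    have C: "0 < C" using wx0 by (simp add: C_def w_def s_def)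
    \<comment> \<open>\<open>X\<close> is the gap between the two sides of the equation; the bend \<open>\<epsilon>\<close> uses up half of it.\<close>
    define X where "X = (lam - \<mu> ^ 4) * (k * C) ^ 3"
    have X: "0 < X" using \<mu>(3) k C by (simp add: X_def)
    define W1 where "W1 = k * \<mu> * D"
    have W1: "W1 \<noteq> 0" using k(1) \<mu>(1) D by (simp add: W1_def)
    define \<epsilon> where "\<epsilon> = X / (2 * W1\<^sup>2)"
    have \<epsilon>: "0 < \<epsilon>" using X W1 by (simp add: \<epsilon>_def)
    define W2 where "W2 = k * (\<mu>\<^sup>2 * - (C ^ 3 / D\<^sup>2)) - \<epsilon>"
    \<comment> \<open>The solution of the linear system that gives the quartic the value \<open>k C\<close>, slope \<open>W1\<close> and
      second derivative \<open>W2\<close> at radius \<open>s\<close>.\<close>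
    define c where "c = (W2 - W1 / s) / (8 * s\<^sup>2)"
    define b where "b = (W1 / s - 4 * c * s\<^sup>2) / 2"
    define a where "a = k * C - b * s\<^sup>2 - c * s ^ 4"
    have g1: "2 * b * s + 4 * c * s ^ 3 = W1"
      using s by (simp add: b_def field_simps power2_eq_square power3_eq_cube)
    have "8 * s\<^sup>2 * c = W2 - W1 / s"
      using s by (simp add: c_def)
    moreover have "2 * b = W1 / s - 4 * c * s\<^sup>2"
      by (simp add: b_def)
    ultimately have g2: "2 * b + 12 * c * s\<^sup>2 = W2"
      by (simp add: algebra_simps)
    define h where "h t = k * qcos (\<mu> * t) - (a + b * t\<^sup>2 + c * t ^ 4)" for t
    define h' where "h' t = k * (\<mu> * qcos' (\<mu> * t)) - (2 * b * t + 4 * c * t ^ 3)" for t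
    have "\<forall>\<^sub>F t in at s. h s < h t"
    proof (rule strict_local_min_second_derivative)
      show "\<forall>\<^sub>F t in nhds s. (h has_real_derivative h' t) (at t)"
        unfolding h_def h'_def
        by (intro always_eventually allI) (auto intro!: derivative_eq_intros)
      show "h' s = 0"
        unfolding h'_def g1 by (simp add: W1_def D_def)
      have "(qcos' has_real_derivative - (C ^ 3 / D\<^sup>2)) (at (\<mu> * s))"
        using DERIV_qcos_regular(2)[of "\<mu> * s"] D by (simp add: C_def D_def)
      moreover have "((\<lambda>t. \<mu> * t) has_real_derivative \<mu>) (at s)"
        by (auto intro!: derivative_eq_intros)
      ultimately have "((\<lambda>t. qcos' (\<mu> * t)) has_real_derivative - (C ^ 3 / D\<^sup>2) * \<mu>) (at s)"
        by (rule DERIV_chain2[where f = qcos' and g = "\<lambda>t. \<mu> * t" and x = s])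
      then have "(h' has_real_derivative
          k * (\<mu> * (- (C ^ 3 / D\<^sup>2) * \<mu>)) - (2 * b + 4 * c * (3 * s\<^sup>2))) (at s)"
        unfolding h'_def by (auto intro!: derivative_eq_intros)
      also have "k * (\<mu> * (- (C ^ 3 / D\<^sup>2) * \<mu>)) - (2 * b + 4 * c * (3 * s\<^sup>2)) = \<epsilon>"
        using g2 by (simp add: W2_def power2_eq_square mult_ac)
      finally show "(h' has_real_derivative \<epsilon>) (at s)" .
    qed (rule \<epsilon>)
    moreover have "h s = 0"
      by (simp add: h_def a_def C_def)
    ultimately have "\<forall>\<^sub>F t in nhds s. 0 \<le> h t"
      unfolding eventually_at_filter by (auto elim!: eventually_mono)
    then have "\<forall>\<^sub>F x in nhds x0. 0 \<le> h (norm (x - y))"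
      unfolding s_def by (rule eventually_compose_filterlim[OF _ filterlim_norm_diff])
    moreover have "\<forall>\<^sub>F x in nhds x0. x \<in> ball y \<rho>"
      using \<open>s < \<rho>\<close> by (intro eventually_nhds_in_open) (auto simp: s_def dist_norm norm_minus_commute)
    ultimately have "\<forall>\<^sub>F x in nhds x0. 0 \<le> u x - radial_quartic a b c y x"
    proof eventually_elim
      case (elim x)
      then have "k * w x \<le> u x" by (intro above) auto
      then show ?case using elim by (simp add: h_def radial_quartic_def w_def)
    qed
    moreover have "u x0 - radial_quartic a b c y x0 = 0"
      using k(2) by (simp add: radial_quartic_def s_def[symmetric] a_def w_def C_def)
    ultimately have "local_min_at S (\<lambda>x. u x - radial_quartic a b c y x) x0"
      using x0(1) S by (intro local_min_atI) auto
    then have "inf_laplacian (radial_quartic a b c y) x0 \<le> - lam * u x0 ^ 3"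
      using u(1) radial_quartic_C2(1) unfolding visc_le_def by blast
    then have "W1\<^sup>2 * W2 \<le> - lam * (k * C) ^ 3"
      using k(2) unfolding radial_quartic_C2(2) s_def[symmetric] g1 g2
      by (simp add: w_def C_def s_def)
    moreover have "W1\<^sup>2 * \<epsilon> = X / 2"
      using W1 by (simp add: \<epsilon>_def)
    moreover have "W1\<^sup>2 * W2 = - (\<mu> ^ 4) * (k * C) ^ 3 - W1\<^sup>2 * \<epsilon>"
      using D unfolding W2_def right_diff_distrib
      by (simp add: W1_def field_simps power2_eq_square power3_eq_cube power4_eq_xxxx)
    ultimately have "X \<le> X / 2"
      by (simp add: X_def algebra_simps)
    then show False using X by simp
  qed
  then show ?thesis
    using above[OF x] k(2) by (simp add: w_def)
qed

lemma has_derivative_zero_squeeze: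
  fixes f :: "'a::real_normed_vector \<Rightarrow> real"
  assumes "(g has_derivative (\<lambda>_. 0)) (at y)" "g y = 0"
    and "\<forall>\<^sub>F x in at y. \<bar>f x - f y\<bar> \<le> g x"
  shows "(f has_derivative (\<lambda>_. 0)) (at y)"
proof -
  have lim: "((\<lambda>x. \<bar>g x\<bar> / norm (x - y)) \<longlongrightarrow> 0) (at y)"
    using assms(1,2) by (simp add: has_derivative_iff_norm)
  have "((\<lambda>x. \<bar>f x - f y\<bar> / norm (x - y)) \<longlongrightarrow> 0) (at y)"
  proof (rule tendsto_sandwich[OF _ _ tendsto_const lim])
    show "\<forall>\<^sub>F x in at y. \<bar>f x - f y\<bar> / norm (x - y) \<le> \<bar>g x\<bar> / norm (x - y)"
      using assms(3) by eventually_elim (auto intro!: divide_right_mono)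
  qed simp
  then show ?thesis by (simp add: has_derivative_iff_norm)
qed

text \<open>
  If \<open>lam\<close> were larger, then balls of a radius \<open>\<rho> < r\<close> would have first eigenvalue below \<open>lam\<close>,
  and these fit into \<open>ball z r\<close> around every centre near \<open>z\<close>.  A single ball does not
  give a contradiction, because the contact may take place at the non-\<open>C\<^sup>2\<close> crest of the bump.
  Moving the centre does: \<open>supersolution_above_bump\<close> holds at every point \<open>y\<close> near \<open>z\<close>, and with
  the roles of \<open>x\<close> and \<open>y\<close> exchanged it bounds \<open>\<bar>u x - u y\<bar>\<close> by a multiple of
  \<open>1 - qcos (\<mu> \<bar>x - y\<bar>)\<close>, which is \<open>o(\<bar>x - y\<bar>)\<close>.  So \<open>u\<close> is constant near \<open>z\<close>, and a positive
  constant is not a supersolution.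
\<close>

theorem positive_supersolution_bound:
  fixes z :: "real^'n"
  assumes S: "ball z r \<subseteq> S" and r: "0 < r"
    and u: "visc_le S (\<lambda>x t. - lam * t ^ 3) u" "\<And>x. x \<in> ball z r \<Longrightarrow> 0 < u x"
  shows "lam \<le> beta_const / r ^ 4"
proof (rule ccontr)
  let ?A = quarter_period
  assume "\<not> lam \<le> beta_const / r ^ 4"
  then have lam: "(?A / r) ^ 4 < lam"
    by (simp add: beta_const_eq power_divide)
  have A: "0 < ?A / r" using r quarter_period_pos by simp
  have lam0: "0 < lam" using lam zero_less_power[OF A, of 4] by (rule less_trans[rotated])
  have root: "root 4 lam ^ 4 = lam"
    using lam0 by (intro real_root_pow_pos2) simp_all
  have "?A / r < root 4 lam"
    by (rule power_less_imp_less_base[of _ 4]) (use lam lam0 root in \<open>simp_all only: real_root_ge_zero less_imp_le\<close>)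
  from dense[OF this] obtain \<mu> where \<mu>r: "?A / r < \<mu>" "\<mu> < root 4 lam"
    by (elim exE conjE)
  have \<mu>: "0 < \<mu>" using A \<mu>r(1) by (rule less_trans)
  have "\<mu> ^ 4 < root 4 lam ^ 4"
    by (rule power_strict_mono) (use \<mu> \<mu>r(2) in simp_all)
  then have \<mu>lam: "\<mu> ^ 4 < lam" by (simp only: root)
  define \<rho> where "\<rho> = ?A / \<mu>"
  have \<rho>: "0 < \<rho>" "\<mu> * \<rho> = ?A"
    using \<mu> quarter_period_pos by (simp_all add: \<rho>_def)
  have "?A < \<mu> * r"
    using \<mu>r(1) r by (simp only: pos_divide_less_eq)
  then have \<rho>r: "\<rho> < r"
    using \<mu> by (simp add: \<rho>_def pos_divide_less_eq mult.commute)
  define \<delta> where "\<delta> = r - \<rho>"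
  have bump: "u y * qcos (\<mu> * norm (x - y)) \<le> u x" if "y \<in> ball z \<delta>" "x \<in> cball y \<rho>" for x y
  proof -
    have sub: "cball y \<rho> \<subseteq> ball z r"
      using that(1) unfolding cball_subset_ball_iff by (simp add: \<delta>_def dist_commute)
    show ?thesis
    proof (rule supersolution_above_bump[OF _ \<mu> \<rho>(2) \<mu>lam u(1) _ that(2)])
      show "cball y \<rho> \<subseteq> S" using sub S by blast
      show "0 < u x" if "x \<in> cball y \<rho>" for x using sub u(2) that by blast
    qed
  qed
  have ball_sub: "x \<in> ball z r" if "x \<in> ball z \<delta>" for x
    using that \<rho>(1) by (simp add: \<delta>_def)
  have deriv: "(u has_derivative (\<lambda>_. 0)) (at y)" if y: "y \<in> ball z \<delta>" for y
  proof (rule has_derivative_zero_squeeze)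
    \<comment> \<open>The factor \<open>2\<close> absorbs \<open>u x \<le> 2 * u y\<close>, which holds close to \<open>y\<close> where the bump exceeds \<open>1/2\<close>.\<close>
    define f where "f t = 2 * u y * (1 - qcos (\<mu> * t))" for t
    have "(f has_real_derivative 0) (at 0)"
      unfolding f_def by (auto intro!: derivative_eq_intros)
    from has_derivative_radial_flat[OF this]
    show "((\<lambda>x. f (norm (x - y))) has_derivative (\<lambda>_. 0)) (at y)" .
    show "f (norm (y - y)) = 0" by (simp add: f_def)
    have "((\<lambda>x. qcos (\<mu> * norm (x - y))) \<longlongrightarrow> 1) (at y)"
    proof -
      have "isCont (\<lambda>x. radial_wave 1 \<mu> 0 y x) y"
        using continuous_on_radial_wave[of UNIV 1 \<mu> 0 y] by (simp add: continuous_on_eq_continuous_at)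
      then show ?thesis by (simp add: radial_wave_def isCont_def)
    qed
    then have "\<forall>\<^sub>F x in at y. 1 / 2 < qcos (\<mu> * norm (x - y))"
      by (rule order_tendstoD) simp
    moreover have "\<forall>\<^sub>F x in at y. x \<in> ball z \<delta> \<inter> ball y \<rho>"
      using y \<rho>(1) by (intro eventually_at_in_open') auto
    ultimately show "\<forall>\<^sub>F x in at y. \<bar>u x - u y\<bar> \<le> f (norm (x - y))"
    proof eventually_elim
      case (elim x)
      let ?q = "qcos (\<mu> * norm (x - y))"
      have q1: "?q \<le> 1"
      proof -
        have "0 \<le> qcos' (\<mu> * norm (x - y)) ^ 4"
          by (rule zero_le_even_power) simp
        then have "?q ^ 4 \<le> 1 ^ 4"
          using qcos_energy[of "\<mu> * norm (x - y)"] unfolding power_one by linarith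
        then show ?thesis
          by (rule power_mono_iff[THEN iffD1, rotated 3]) (use elim(1) in auto)
      qed
      have pos: "0 < u x" "0 < u y"
        using elim y ball_sub u(2) by auto
      have 1: "u y * ?q \<le> u x" using elim y by (intro bump) auto
      have 2: "u x * ?q \<le> u y"
        using elim bump[of x y] by (auto simp: norm_minus_commute dist_commute)
      have "u x * (1 / 2) \<le> u x * ?q"
        using elim(1) pos by (intro mult_left_mono) auto
      then have "u x \<le> 2 * u y" using 2 by simp
      then have "u x * (1 - ?q) \<le> 2 * u y * (1 - ?q)"
        using q1 by (intro mult_right_mono) auto
      moreover have "u y * (1 - ?q) \<le> 2 * u y * (1 - ?q)"
        using q1 pos by (intro mult_right_mono) auto
      ultimately show ?case
        unfolding f_def abs_le_iff using 1 2 by (simp add: algebra_simps)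
    qed
  qed
  have "\<exists>k. \<forall>x\<in>ball z \<delta>. u x = k"
  proof (rule has_derivative_zero_constant[OF convex_ball])
    show "(u has_derivative (\<lambda>h. 0)) (at x within ball z \<delta>)" if "x \<in> ball z \<delta>" for x
      using deriv[OF that] by (rule has_derivative_at_withinI)
  qed
  then obtain k where k: "\<And>x. x \<in> ball z \<delta> \<Longrightarrow> u x = k" by blast
  have z: "z \<in> ball z \<delta>" "z \<in> S"
    using \<rho>r r by (simp add: \<delta>_def) (rule subsetD[OF S], simp add: r)
  have "\<forall>\<^sub>F x in nhds z. x \<in> ball z \<delta>"
    using z by (intro eventually_nhds_in_open) auto
  then have "\<forall>\<^sub>F x in nhds z. u z - radial_quartic 0 0 0 z z \<le> u x - radial_quartic 0 0 0 z x"
    by eventually_elim (simp add: k[OF z(1)] k radial_quartic_def del: mem_ball)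
  then have "local_min_at S (\<lambda>x. u x - radial_quartic 0 0 0 z x) z"
    using z by (intro local_min_atI)
  then have "inf_laplacian (radial_quartic 0 0 0 z) z \<le> - lam * u z ^ 3"
    using u(1) radial_quartic_C2(1) unfolding visc_le_def by blast
  then have "lam * u z ^ 3 \<le> 0"
    by (simp add: radial_quartic_C2(2))
  moreover have "0 < lam * u z ^ 3"
    using lam0 u(2)[of z] r by simp
  ultimately show False by simp
qed

section \<open>Eigenvalues of balls and annuli\<close>


text \<open>
  Here \<open>S\<close> is a ball (\<open>m = 0\<close>) or an annulus with middle radius \<open>m\<close>.  Below the critical value the
  wave is still positive where it reaches the boundary and can be scaled to the value \<open>\<delta>\<close> there.
\<close>

lemma wave_in_eigen_set:
  fixes q :: "real^'n"
  assumes S: "open S" "q \<notin> S \<or> m = 0"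
    and bdry: "\<And>x. x \<in> closure S \<Longrightarrow> \<bar>norm (x - q) - m\<bar> \<le> r"
      "\<And>x. x \<in> frontier S \<Longrightarrow> \<bar>norm (x - q) - m\<bar> = r"
    and "0 < r" "0 < \<delta>" "0 < lam" "lam < beta_const / r ^ 4"
  shows "lam \<in> eigen_set \<delta> S"
proof -
  define \<mu> where "\<mu> = root 4 lam"
  have \<mu>: "0 < \<mu>" "\<mu> ^ 4 = lam"
    using \<open>0 < lam\<close> by (simp_all add: \<mu>_def real_root_pow_pos2)
  have "0 < r ^ 4" using \<open>0 < r\<close> by (rule zero_less_power)
  then have "lam * r ^ 4 < quarter_period ^ 4"
    using assms(8) by (simp only: beta_const_eq pos_less_divide_eq)
  then have "(\<mu> * r) ^ 4 < quarter_period ^ 4"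
    by (simp only: power_mult_distrib \<mu>(2))
  then have \<mu>r: "\<mu> * r < quarter_period"
    by (rule power_less_imp_less_base) (use quarter_period_pos in simp)
  have pos: "0 < qcos (\<mu> * t)" if "\<bar>t\<bar> \<le> r" for t
  proof (rule qcos_pos)
    have "\<mu> * \<bar>t\<bar> \<le> \<mu> * r" using that \<mu>(1) by (intro mult_left_mono) auto
    also note \<mu>r
    finally show "\<bar>\<mu> * t\<bar> < quarter_period" using \<mu>(1) by (simp add: abs_mult)
  qed
  have r: "0 < qcos (\<mu> * r)" using pos[of r] \<open>0 < r\<close> by simp
  define u where "u = radial_wave (\<delta> / qcos (\<mu> * r)) \<mu> m q"
  have "u x = \<delta>" if "x \<in> frontier S" for x
  proof -
    have "norm (x - q) - m = r \<or> norm (x - q) - m = - r"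
      using bdry(2)[OF that] by linarith
    then show ?thesis
      using r qcos_even[of "\<mu> * r"] by (auto simp: u_def radial_wave_def)
  qed
  moreover have "visc_eq S (\<lambda>x t. - lam * t ^ 3) u"
    using radial_wave_visc_eq[OF S \<mu>(1)] \<mu>(2) by (simp add: u_def)
  ultimately have "dirichlet_solution S lam \<delta> u"
    by (simp add: dirichlet_solution_def u_def continuous_on_radial_wave)
  moreover have "0 < u x" if "x \<in> closure S" for x
    using pos[OF bdry(1)[OF that]] r \<open>0 < \<delta>\<close> by (simp add: u_def radial_wave_def)
  ultimately show ?thesis
    using \<open>0 < lam\<close> unfolding eigen_set_def
    by (intro CollectI conjI exI[of _ u] ballI) simp_all
qed

text \<open>
  The radius \<open>r\<close> appears twice: it is the distance in which the wave centred at radius \<open>m\<close> reaches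
  the boundary, giving the lower bound, and the radius of a ball inside \<open>S\<close>, giving the upper one.
\<close>

lemma first_eigenvalue_eqI:
  fixes q z :: "real^'n"
  assumes S: "open S" "q \<notin> S \<or> m = 0"
    and bdry: "\<And>x. x \<in> closure S \<Longrightarrow> \<bar>norm (x - q) - m\<bar> \<le> r"
      "\<And>x. x \<in> frontier S \<Longrightarrow> \<bar>norm (x - q) - m\<bar> = r"
    and ball: "ball z r \<subseteq> S" and pos: "0 < r" "0 < \<delta>"
  shows "first_eigenvalue \<delta> S = ereal (beta_const / r ^ 4)"
  unfolding first_eigenvalue_def
proof (rule antisym)
  show "(SUP lam\<in>eigen_set \<delta> S. ereal lam) \<le> ereal (beta_const / r ^ 4)"
  proof (rule SUP_least)
    fix lam assume "lam \<in> eigen_set \<delta> S"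
    then obtain u where "dirichlet_solution S lam \<delta> u" and u: "\<And>x. x \<in> closure S \<Longrightarrow> 0 < u x"
      by (auto simp: eigen_set_def)
    then have "visc_le S (\<lambda>x t. - lam * t ^ 3) u"
      by (simp add: dirichlet_solution_def visc_eq_def)
    then have "lam \<le> beta_const / r ^ 4"
      using u ball closure_subset by (intro positive_supersolution_bound[OF ball pos(1)]) blast+
    then show "ereal lam \<le> ereal (beta_const / r ^ 4)" by simp
  qed
  show "ereal (beta_const / r ^ 4) \<le> (SUP lam\<in>eigen_set \<delta> S. ereal lam)"
    unfolding le_SUP_iff
  proof (intro allI impI)
    fix y assume y: "y < ereal (beta_const / r ^ 4)"
    have "0 < beta_const / r ^ 4"
      using pos(1) quarter_period_pos by (simp add: beta_const_eq)
    with y have "max y 0 < ereal (beta_const / r ^ 4)" by (simp add: zero_ereal_def)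
    then obtain lam where lam: "max y 0 < ereal lam" "ereal lam < ereal (beta_const / r ^ 4)"
      using ereal_dense2 by blast
    then have "lam \<in> eigen_set \<delta> S"
      using pos by (intro wave_in_eigen_set[OF S bdry]) (auto simp: zero_ereal_def)
    then show "\<exists>lam\<in>eigen_set \<delta> S. y < ereal lam"
      using lam by (auto simp: less_ereal.simps)
  qed
qed

lemma eigenfunction_ball:
  fixes p :: "real^'n"
  assumes "0 < R"
  shows "\<exists>u. eigenfunction (ball p R) (beta_const * (2 * real k + 1) ^ 4 / R ^ 4) u
           \<and> radial_on (closure (ball p R)) p u"
proof -
  define \<mu> where "\<mu> = (2 * real k + 1) * quarter_period / R"
  have \<mu>: "0 < \<mu>" using assms quarter_period_pos by (simp add: \<mu>_def)
  have lam: "beta_const * (2 * real k + 1) ^ 4 / R ^ 4 = \<mu> ^ 4"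
    by (simp add: \<mu>_def beta_const_eq power_mult_distrib power_divide)
  let ?u = "radial_wave 1 \<mu> 0 p"
  have "?u x = 0" if "norm (x - p) = R" for x
    using that assms qcos_zero[of k] by (simp add: radial_wave_def \<mu>_def)
  then have "\<forall>x\<in>frontier (ball p R). ?u x = 0"
    using assms by (auto simp: dist_norm norm_minus_commute)
  moreover have "visc_eq (ball p R) (\<lambda>x t. - (\<mu> ^ 4) * t ^ 3) ?u"
    using \<mu> by (intro radial_wave_visc_eq) auto
  moreover have "p \<in> closure (ball p R)" "?u p \<noteq> 0"
    using assms by (auto simp: radial_wave_def)
  ultimately have "eigenfunction (ball p R) (\<mu> ^ 4) ?u"
    unfolding eigenfunction_def dirichlet_solution_def
    by (intro conjI bexI[of _ p]) (simp_all only: continuous_on_radial_wave not_False_eq_True)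
  moreover have "radial_on (closure (ball p R)) p ?u"
    unfolding radial_on_def radial_wave_def
    by (intro exI[of _ "\<lambda>t. 1 * qcos (\<mu> * (t - 0))"] ballI refl)
  ultimately show ?thesis unfolding lam by blast
qed

theorem lemma6p3:
  fixes p :: "real^'n" and R :: real
  assumes "CARD('n) \<ge> 2" and "R > 0"
  shows "infinite {lam. eigenvalue (ball p R) lam}
    \<and> (\<forall>l::nat. l \<ge> 1 \<longrightarrow>
         (\<exists>u. eigenfunction (ball p R) (beta_const * (2 * real l - 1) ^ 4 / R ^ 4) u
            \<and> radial_on (closure (ball p R)) p u))
    \<and> (\<forall>(q :: real^'n) (\<kappa> :: real) (\<tau> :: real) (r :: real) (\<delta> :: real).
         0 \<le> \<kappa> \<and> \<kappa> < \<tau> \<and> 2 * r = \<tau> - \<kappa> \<and> \<delta> > 0 \<longrightarrow>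
           first_eigenvalue \<delta> {x. \<kappa> < norm (x - q) \<and> norm (x - q) < \<tau>}
             = first_eigenvalue \<delta> (ball q r)
         \<and> first_eigenvalue \<delta> (ball q r) = ereal (beta_const / r ^ 4))"
proof (intro conjI allI impI)
  let ?lam = "\<lambda>k::nat. beta_const * (2 * real k + 1) ^ 4 / R ^ 4"
  have "beta_const > 0" using quarter_period_pos by (simp add: beta_const_eq)
  have "inj ?lam"
  proof (rule injI)
    fix j k assume "?lam j = ?lam k"
    then have "(2 * real j + 1) ^ 4 = (2 * real k + 1) ^ 4"
      using \<open>beta_const > 0\<close> \<open>R > 0\<close> by simp
    then have "2 * real j + 1 = 2 * real k + 1"
      by (rule power_eq_imp_eq_base) simp_all
    then show "j = k" by simp
  qed
  then have "infinite (range ?lam)"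
    by (rule range_inj_infinite)
  moreover have "range ?lam \<subseteq> {lam. eigenvalue (ball p R) lam}"
    using eigenfunction_ball[OF \<open>R > 0\<close>] by (auto simp: eigenvalue_def)
  ultimately show "infinite {lam. eigenvalue (ball p R) lam}"
    using infinite_super by blast
next
  fix l :: nat assume "1 \<le> l"
  then have "2 * real (l - 1) + 1 = 2 * real l - 1" by (simp add: of_nat_diff)
  then show "\<exists>u. eigenfunction (ball p R) (beta_const * (2 * real l - 1) ^ 4 / R ^ 4) u
            \<and> radial_on (closure (ball p R)) p u"
    using eigenfunction_ball[OF \<open>R > 0\<close>, of p "l - 1"] by simp
next
  fix q :: "real^'n" and \<kappa> \<tau> r \<delta> :: real
  assume asm: "0 \<le> \<kappa> \<and> \<kappa> < \<tau> \<and> 2 * r = \<tau> - \<kappa> \<and> \<delta> > 0"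
  then have r: "0 < r" "0 < \<delta>" by auto
  show B: "first_eigenvalue \<delta> (ball q r) = ereal (beta_const / r ^ 4)"
    by (rule first_eigenvalue_eqI[where q = q and m = 0 and z = q])
      (use r in \<open>auto simp: dist_norm norm_minus_commute\<close>)
  let ?\<Omega> = "{x. \<kappa> < norm (x - q) \<and> norm (x - q) < \<tau>}"
  define m where "m = (\<kappa> + \<tau>) / 2"
  have km: "\<kappa> = m - r" "\<tau> = m + r" using asm by (auto simp: m_def field_simps)
  have "open ?\<Omega>"
    by (intro open_Collect_conj open_Collect_less continuous_intros)
  have "closed {x. \<kappa> \<le> norm (x - q) \<and> norm (x - q) \<le> \<tau>}"
    by (intro closed_Collect_conj closed_Collect_le continuous_intros)
  then have cl: "closure ?\<Omega> \<subseteq> {x. \<kappa> \<le> norm (x - q) \<and> norm (x - q) \<le> \<tau>}"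
    by (rule closure_minimal[rotated]) auto
  obtain e :: "real^'n" where e: "norm e = 1"
    using radial_direction_exists by blast
  have "first_eigenvalue \<delta> ?\<Omega> = ereal (beta_const / r ^ 4)"
  proof (rule first_eigenvalue_eqI[where q = q and m = m and z = "q + m *\<^sub>R e"])
    show "q \<notin> ?\<Omega> \<or> m = 0" using asm by simp
    show "\<bar>norm (x - q) - m\<bar> \<le> r" if "x \<in> closure ?\<Omega>" for x
    proof -
      have "m - r \<le> norm (x - q)" "norm (x - q) \<le> m + r"
        using that cl km by auto
      then show ?thesis by linarith
    qed
    show "\<bar>norm (x - q) - m\<bar> = r" if "x \<in> frontier ?\<Omega>" for x
    proof -
      have "x \<in> closure ?\<Omega>" "x \<notin> ?\<Omega>"
        using that \<open>open ?\<Omega>\<close> by (simp_all add: frontier_def interior_open)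
      then have "m - r \<le> norm (x - q)" "norm (x - q) \<le> m + r"
        "\<not> (m - r < norm (x - q) \<and> norm (x - q) < m + r)"
        using cl km by auto
      then show ?thesis by linarith
    qed
    show "ball (q + m *\<^sub>R e) r \<subseteq> ?\<Omega>"
    proof
      fix x assume "x \<in> ball (q + m *\<^sub>R e) r"
      then have "norm ((x - q) - m *\<^sub>R e) < r"
        by (simp add: dist_norm norm_minus_commute algebra_simps)
      moreover have "norm (m *\<^sub>R e) = m" using asm e by (simp add: m_def)
      ultimately have "m - r < norm (x - q)" "norm (x - q) < m + r"
        using norm_triangle_ineq3[of "x - q" "m *\<^sub>R e"] by linarith+
      then show "x \<in> ?\<Omega>" using km by simp
    qed
  qed (fact \<open>open ?\<Omega>\<close> r)+
  then show "first_eigenvalue \<delta> ?\<Omega> = first_eigenvalue \<delta> (ball q r)"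
    using B by simp
qed

end
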